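(* On the category $\mathsf{CRig}_g^{\sigma}$, the maps $\sigma_S:\mathrm{ZId}(S)\to\mathrm{Id}_g(S)$, $\sigma_S(I)=I^g$, form a natural transformation $\sigma:\mathrm{ZId}\Rightarrow\mathrm{Id}_g$ of functors to $\mathsf{CohFrm}$.
   Context: A semiring here is commutative with $0$ and $1$: $(S,+,0)$ and $(S,\cdot,1)$ are commutative monoids, multiplication distributes over addition, and $0s=0$; homomorphisms preserve $0$ and $1$. An ideal is a non-empty subset closed under addition and under multiplication by arbitrary elements; maximal ideals are proper; $\mathrm{Id}(S)$ is the set of all ideals. With $\mathcal M(a)$ the set of maximal ideals containing $a$, an ideal $I$ is a $z$-ideal if $a\in I$ and $\mathcal M(a)=\mathcal M(b)$ imply $b\in I$. $\mathfrak{cl}_z(I)$ is the intersection of all $z$-ideals containing $I$, and $\langle a\rangle_z=\mathfrak{cl}_z(\langle a\rangle)$. $\mathrm{ZId}(S)$ is the coherent frame of $z$-ideals under inclusion, with meet $\cap$ and joins $\bigvee^z_\lambda I_\lambda=\mathfrak{cl}_z(\sum_\lambda I_\lambda)$. A congruence is an equivalence relation compatible with $+$ and $\cdot$; maximal congruences are maximal among proper ones ($\neq S\times S$). The zero-class of $\theta$ is $0_\theta=\{a\mid(a,0)\in\theta\}$. For an ideal $I$, $\wp_I$ is the intersection of all maximal congruences $\theta$ with $I\subseteq0_\theta$ ($S\times S$ if there are none), $g(I)=I^g=0_{\wp_I}$, and $I$ is $g$-closed if $I=I^g$. $\mathrm{Id}_g(S)$ is the set of $g$-closed ideals ordered by inclusion;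 $\langle a\rangle_g=(\langle a\rangle)^g$, and $g$-joins are $\bigvee^g_\lambda I_\lambda=(\sum_\lambda I_\lambda)^g$, with binary join $\vee_g$. $S$ satisfies the finite-type $g$-closure hypothesis if: (G1) $g:\mathrm{Id}(S)\to\mathrm{Id}(S)$ is of finite type (each element of $I^g$ lies in $F^g$ for some finitely generated ideal $F\subseteq I$); (G2) the fixed points of $g$ form a frame with meet given by intersection and join given by $g$ applied to sums; (G3) the compact elements of this frame are exactly the finite $g$-joins $\langle a_1\rangle_g\vee_g\cdots\vee_g\langle a_n\rangle_g$; (G4) $\langle a\rangle_g\cap\langle b\rangle_g=\langle ab\rangle_g$ for all $a,b\in S$, and hence finite $g$-joins of principal $g$-closures are closed under finite meets. Under this hypothesis $\mathrm{Id}_g(S)$ is a coherent frame. $\mathsf{CRig}_g$ is the category whose objects are the commutative semirings satisfying the finite-type $g$-closure hypothesis and whose morphisms are semiring homomorphisms $\varphi:S\to T$ such that inverse images of $z$-ideals of $T$ are $z$-ideals of $S$ and inverse images of $g$-closed ideals of $T$ are $g$-closed in $S$. On morphisms, $\mathrm{ZId}(\varphi)(I)=\bigvee^z_{a\in I}\langle\varphi(a)\rangle_z$ and $\mathrm{Id}_g(\varphi)(I)=\bigvee^g_{a\in I}\langle\varphi(a)\rangle_g$; these make $\mathrm{ZId}$ and $\mathrm{Id}_g$ functors to $\mathsf{CohFrm}$, the category of coherent frames (top compact, every element a join of compact elements, compact elements closed under finite meets) and frame homomorphisms preserving compact elements (coherent frame homomorphisms). $\mathsf{CRig}_g^{\sigma}$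 is the subcategory of $\mathsf{CRig}_g$ whose objects $S$ are those for which $\sigma_S$ is a coherent frame homomorphism, and whose morphisms $\varphi:S\to T$ satisfy $\mathrm{Id}_g(\varphi)((\langle a\rangle_z)^g)=(\langle\varphi(a)\rangle_z)^g$ for every $a\in S$. *)

theory Defs
  imports "HOL-Algebra.Ring" "HOL-Algebra.Complete_Lattice"
begin

section \<open>Categories, functors and natural transformations\<close>

text \<open>
  Arrows do not carry their domain and codomain; hom-sets, composition and the arrow part of a
  functor are therefore indexed by the objects involved.
  \<open>Cmp C X Y Z g f\<close> is the composite of \<open>f : X \<rightarrow> Y\<close> followed by \<open>g : Y \<rightarrow> Z\<close>.
\<close>

record ('o, 'm) cat =
  Obj :: "'o set"
  Hom :: "'o \<Rightarrow> 'o \<Rightarrow> 'm set"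
  Idm :: "'o \<Rightarrow> 'm"
  Cmp :: "'o \<Rightarrow> 'o \<Rightarrow> 'o \<Rightarrow> 'm \<Rightarrow> 'm \<Rightarrow> 'm"

definition is_category :: "('o, 'm) cat \<Rightarrow> bool" where
  "is_category C \<longleftrightarrow>
     (\<forall>X\<in>Obj C. Idm C X \<in> Hom C X X) \<and>
     (\<forall>X\<in>Obj C. \<forall>Y\<in>Obj C. \<forall>Z\<in>Obj C. \<forall>f\<in>Hom C X Y. \<forall>g\<in>Hom C Y Z.
        Cmp C X Y Z g f \<in> Hom C X Z) \<and>
     (\<forall>X\<in>Obj C. \<forall>Y\<in>Obj C. \<forall>f\<in>Hom C X Y.
        Cmp C X X Y f (Idm C X) = f \<and> Cmp C X Y Y (Idm C Y) f = f) \<and>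
     (\<forall>W\<in>Obj C. \<forall>X\<in>Obj C. \<forall>Y\<in>Obj C. \<forall>Z\<in>Obj C.
        \<forall>f\<in>Hom C W X. \<forall>g\<in>Hom C X Y. \<forall>h\<in>Hom C Y Z.
        Cmp C W Y Z h (Cmp C W X Y g f) = Cmp C W X Z (Cmp C X Y Z h g) f)"

record ('o, 'm, 'p, 'n) funct =
  omap :: "'o \<Rightarrow> 'p"
  amap :: "'o \<Rightarrow> 'o \<Rightarrow> 'm \<Rightarrow> 'n"

definition is_functor ::
    "('o, 'm) cat \<Rightarrow> ('p, 'n) cat \<Rightarrow> ('o, 'm, 'p, 'n) funct \<Rightarrow> bool" where
  "is_functor C D F \<longleftrightarrow>
     is_category C \<and> is_category D \<and>
     (\<forall>X\<in>Obj C. omap F X \<in> Obj D) \<and>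
     (\<forall>X\<in>Obj C. \<forall>Y\<in>Obj C. \<forall>f\<in>Hom C X Y. amap F X Y f \<in> Hom D (omap F X) (omap F Y)) \<and>
     (\<forall>X\<in>Obj C. amap F X X (Idm C X) = Idm D (omap F X)) \<and>
     (\<forall>X\<in>Obj C. \<forall>Y\<in>Obj C. \<forall>Z\<in>Obj C. \<forall>f\<in>Hom C X Y. \<forall>g\<in>Hom C Y Z.
        amap F X Z (Cmp C X Y Z g f)
          = Cmp D (omap F X) (omap F Y) (omap F Z) (amap F Y Z g) (amap F X Y f))"

definition is_natural_transformation ::
    "('o, 'm) cat \<Rightarrow> ('p, 'n) cat \<Rightarrow> ('o, 'm, 'p, 'n) funct \<Rightarrow> ('o, 'm, 'p, 'n) funct
      \<Rightarrow> ('o \<Rightarrow> 'n) \<Rightarrow> bool" where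
  "is_natural_transformation C D F G \<tau> \<longleftrightarrow>
     is_functor C D F \<and> is_functor C D G \<and>
     (\<forall>X\<in>Obj C. \<tau> X \<in> Hom D (omap F X) (omap G X)) \<and>
     (\<forall>X\<in>Obj C. \<forall>Y\<in>Obj C. \<forall>f\<in>Hom C X Y.
        Cmp D (omap F X) (omap F Y) (omap G Y) (\<tau> Y) (amap F X Y f)
          = Cmp D (omap F X) (omap G X) (omap G Y) (amap G X Y f) (\<tau> X))"


section \<open>Coherent frames\<close>

definition is_frame :: "'b gorder \<Rightarrow> bool" where
  "is_frame L \<longleftrightarrow> complete_lattice L \<and>
     (\<forall>x\<in>carrier L. \<forall>A. A \<subseteq> carrier L \<longrightarrow>
        x \<sqinter>\<^bsub>L\<^esub> (\<Squnion>\<^bsub>L\<^esub> A) = \<Squnion>\<^bsub>L\<^esub> ((\<lambda>a. x \<sqinter>\<^bsub>L\<^esub> a) ` A))"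

definition compacts :: "'b gorder \<Rightarrow> 'b set" where
  "compacts L = {k \<in> carrier L. \<forall>A. A \<subseteq> carrier L \<longrightarrow> k \<sqsubseteq>\<^bsub>L\<^esub> \<Squnion>\<^bsub>L\<^esub> A \<longrightarrow>
                   (\<exists>F. finite F \<and> F \<subseteq> A \<and> k \<sqsubseteq>\<^bsub>L\<^esub> \<Squnion>\<^bsub>L\<^esub> F)}"

definition coherent_frame :: "'b gorder \<Rightarrow> bool" where
  "coherent_frame L \<longleftrightarrow> is_frame L \<and>
     \<top>\<^bsub>L\<^esub> \<in> compacts L \<and>
     (\<forall>x\<in>carrier L. \<exists>K. K \<subseteq> compacts L \<and> x = \<Squnion>\<^bsub>L\<^esub> K) \<and>
     (\<forall>k\<in>compacts L. \<forall>l\<in>compacts L. k \<sqinter>\<^bsub>L\<^esub> l \<in> compacts L)"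

text \<open>
  Maps between carriers are taken extensional (undefined off the carrier), so that equality of
  morphisms is equality of functions.
\<close>

definition frame_hom :: "'b gorder \<Rightarrow> 'c gorder \<Rightarrow> ('b \<Rightarrow> 'c) set" where
  "frame_hom L M = {f \<in> carrier L \<rightarrow>\<^sub>E carrier M.
     f \<top>\<^bsub>L\<^esub> = \<top>\<^bsub>M\<^esub> \<and>
     (\<forall>x\<in>carrier L. \<forall>y\<in>carrier L. f (x \<sqinter>\<^bsub>L\<^esub> y) = f x \<sqinter>\<^bsub>M\<^esub> f y) \<and>
     (\<forall>A. A \<subseteq> carrier L \<longrightarrow> f (\<Squnion>\<^bsub>L\<^esub> A) = \<Squnion>\<^bsub>M\<^esub> (f ` A))}"

definition coherent_frame_hom :: "'b gorder \<Rightarrow> 'c gorder \<Rightarrow> ('b \<Rightarrow> 'c) set" where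
  "coherent_frame_hom L M = {f \<in> frame_hom L M. f ` compacts L \<subseteq> compacts M}"

definition CohFrm :: "('b gorder, 'b \<Rightarrow> 'b) cat" where
  "CohFrm = \<lparr> Obj = {L. coherent_frame L},
              Hom = coherent_frame_hom,
              Idm = (\<lambda>L. \<lambda>x\<in>carrier L. x),
              Cmp = (\<lambda>L M N g f. compose (carrier L) g f) \<rparr>"

definition inclusion_order :: "'a set set \<Rightarrow> 'a set gorder" where
  "inclusion_order X = \<lparr> carrier = X, eq = (=), le = (\<subseteq>) \<rparr>"


section \<open>Semirings and ideals\<close>

text \<open>The zero semiring is allowed, as in the locale \<^locale>\<open>semiring\<close>.\<close>

definition commutative_semiring :: "'a ring \<Rightarrow> bool" where
  "commutative_semiring S \<longleftrightarrow> semiring S \<and> comm_monoid S"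

text \<open>Preservation of zero is not automatic without additive inverses.\<close>

definition semiring_hom :: "'a ring \<Rightarrow> 'b ring \<Rightarrow> ('a \<Rightarrow> 'b) set" where
  "semiring_hom S T = {f \<in> ring_hom S T. f \<in> extensional (carrier S) \<and> f \<zero>\<^bsub>S\<^esub> = \<zero>\<^bsub>T\<^esub>}"

definition semiring_ideal :: "'a ring \<Rightarrow> 'a set \<Rightarrow> bool" where
  "semiring_ideal S I \<longleftrightarrow> I \<subseteq> carrier S \<and> I \<noteq> {} \<and>
     (\<forall>a\<in>I. \<forall>b\<in>I. a \<oplus>\<^bsub>S\<^esub> b \<in> I) \<and>
     (\<forall>s\<in>carrier S. \<forall>a\<in>I. s \<otimes>\<^bsub>S\<^esub> a \<in> I)"

definition maximal_ideal :: "'a ring \<Rightarrow> 'a set \<Rightarrow> bool" where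
  "maximal_ideal S M \<longleftrightarrow> semiring_ideal S M \<and> M \<noteq> carrier S \<and>
     (\<forall>J. semiring_ideal S J \<longrightarrow> M \<subseteq> J \<longrightarrow> J = M \<or> J = carrier S)"

definition ideal_gen :: "'a ring \<Rightarrow> 'a set \<Rightarrow> 'a set" where
  "ideal_gen S A = \<Inter>{I. semiring_ideal S I \<and> A \<subseteq> I}"

definition ideal_sum :: "'a ring \<Rightarrow> 'a set set \<Rightarrow> 'a set" where
  "ideal_sum S \<I> = {finsum S x F | x F. finite F \<and> F \<subseteq> \<I> \<and> x \<in> (\<Pi> I\<in>F. I)}"


section \<open>$z$-ideals\<close>

definition max_ideals_at :: "'a ring \<Rightarrow> 'a \<Rightarrow> 'a set set" where
  "max_ideals_at S a = {M. maximal_ideal S M \<and> a \<in> M}"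

definition z_ideal :: "'a ring \<Rightarrow> 'a set \<Rightarrow> bool" where
  "z_ideal S I \<longleftrightarrow> semiring_ideal S I \<and>
     (\<forall>a\<in>I. \<forall>b\<in>carrier S. max_ideals_at S a = max_ideals_at S b \<longrightarrow> b \<in> I)"

definition zcl :: "'a ring \<Rightarrow> 'a set \<Rightarrow> 'a set" where
  "zcl S I = \<Inter>{J. z_ideal S J \<and> I \<subseteq> J}"

definition zprinc :: "'a ring \<Rightarrow> 'a \<Rightarrow> 'a set" where
  "zprinc S a = zcl S (ideal_gen S {a})"

definition zjoin :: "'a ring \<Rightarrow> 'a set set \<Rightarrow> 'a set" where
  "zjoin S \<I> = zcl S (ideal_sum S \<I>)"

definition ZId :: "'a ring \<Rightarrow> 'a set gorder" where
  "ZId S = inclusion_order {I. z_ideal S I}"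


section \<open>$g$-closed ideals\<close>

definition semiring_congruence :: "'a ring \<Rightarrow> ('a \<times> 'a) set \<Rightarrow> bool" where
  "semiring_congruence S \<theta> \<longleftrightarrow> equiv (carrier S) \<theta> \<and>
     (\<forall>a b c d. (a, b) \<in> \<theta> \<longrightarrow> (c, d) \<in> \<theta> \<longrightarrow>
        (a \<oplus>\<^bsub>S\<^esub> c, b \<oplus>\<^bsub>S\<^esub> d) \<in> \<theta> \<and> (a \<otimes>\<^bsub>S\<^esub> c, b \<otimes>\<^bsub>S\<^esub> d) \<in> \<theta>)"

definition maximal_congruence :: "'a ring \<Rightarrow> ('a \<times> 'a) set \<Rightarrow> bool" where
  "maximal_congruence S \<theta> \<longleftrightarrow> semiring_congruence S \<theta> \<and> \<theta> \<noteq> carrier S \<times> carrier S \<and>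
     (\<forall>\<eta>. semiring_congruence S \<eta> \<longrightarrow> \<theta> \<subseteq> \<eta> \<longrightarrow> \<eta> = \<theta> \<or> \<eta> = carrier S \<times> carrier S)"

definition zero_class :: "'a ring \<Rightarrow> ('a \<times> 'a) set \<Rightarrow> 'a set" where
  "zero_class S \<theta> = {a. (a, \<zero>\<^bsub>S\<^esub>) \<in> \<theta>}"

text \<open>
  The intersection is taken inside \<open>S \<times> S\<close>, which matters only when no maximal congruence
  qualifies; the result is then \<open>S \<times> S\<close>.
\<close>

definition wp :: "'a ring \<Rightarrow> 'a set \<Rightarrow> ('a \<times> 'a) set" where
  "wp S I = (carrier S \<times> carrier S) \<inter>
              \<Inter>{\<theta>. maximal_congruence S \<theta> \<and> I \<subseteq> zero_class S \<theta>}"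

definition gcl :: "'a ring \<Rightarrow> 'a set \<Rightarrow> 'a set" where
  "gcl S I = zero_class S (wp S I)"

definition g_closed :: "'a ring \<Rightarrow> 'a set \<Rightarrow> bool" where
  "g_closed S I \<longleftrightarrow> semiring_ideal S I \<and> I = gcl S I"

definition gprinc :: "'a ring \<Rightarrow> 'a \<Rightarrow> 'a set" where
  "gprinc S a = gcl S (ideal_gen S {a})"

definition gjoin :: "'a ring \<Rightarrow> 'a set set \<Rightarrow> 'a set" where
  "gjoin S \<I> = gcl S (ideal_sum S \<I>)"

definition Idg :: "'a ring \<Rightarrow> 'a set gorder" where
  "Idg S = inclusion_order {I. g_closed S I}"

text \<open>The four clauses of the finite-type $g$-closure hypothesis.\<close>

definition G1 :: "'a ring \<Rightarrow> bool" where
  "G1 S \<longleftrightarrow> (\<forall>I. semiring_ideal S I \<longrightarrow>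
     (\<forall>x\<in>gcl S I. \<exists>A. finite A \<and> A \<subseteq> carrier S \<and> ideal_gen S A \<subseteq> I \<and> x \<in> gcl S (ideal_gen S A)))"

definition G2 :: "'a ring \<Rightarrow> bool" where
  "G2 S \<longleftrightarrow> is_frame (Idg S) \<and>
     (\<forall>I\<in>carrier (Idg S). \<forall>J\<in>carrier (Idg S). I \<sqinter>\<^bsub>Idg S\<^esub> J = I \<inter> J) \<and>
     (\<forall>\<I>. \<I> \<subseteq> carrier (Idg S) \<longrightarrow> \<Squnion>\<^bsub>Idg S\<^esub> \<I> = gjoin S \<I>)"

definition G3 :: "'a ring \<Rightarrow> bool" where
  "G3 S \<longleftrightarrow> compacts (Idg S) = {gjoin S (gprinc S ` A) | A. finite A \<and> A \<subseteq> carrier S}"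

definition G4 :: "'a ring \<Rightarrow> bool" where
  "G4 S \<longleftrightarrow> (\<forall>a\<in>carrier S. \<forall>b\<in>carrier S. gprinc S a \<inter> gprinc S b = gprinc S (a \<otimes>\<^bsub>S\<^esub> b))"

definition finite_type_g_closure :: "'a ring \<Rightarrow> bool" where
  "finite_type_g_closure S \<longleftrightarrow> G1 S \<and> G2 S \<and> G3 S \<and> G4 S"


section \<open>The functors and the transformation\<close>

definition ZId_map :: "'a ring \<Rightarrow> 'b ring \<Rightarrow> ('a \<Rightarrow> 'b) \<Rightarrow> 'a set \<Rightarrow> 'b set" where
  "ZId_map S T \<phi> = (\<lambda>I\<in>carrier (ZId S). zjoin T ((\<lambda>a. zprinc T (\<phi> a)) ` I))"

definition Idg_map :: "'a ring \<Rightarrow> 'b ring \<Rightarrow> ('a \<Rightarrow> 'b) \<Rightarrow> 'a set \<Rightarrow> 'b set" where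
  "Idg_map S T \<phi> = (\<lambda>I\<in>carrier (Idg S). gjoin T ((\<lambda>a. gprinc T (\<phi> a)) ` I))"

definition ZId_functor :: "('a ring, 'a \<Rightarrow> 'a, 'a set gorder, 'a set \<Rightarrow> 'a set) funct" where
  "ZId_functor = \<lparr> omap = ZId, amap = ZId_map \<rparr>"

definition Idg_functor :: "('a ring, 'a \<Rightarrow> 'a, 'a set gorder, 'a set \<Rightarrow> 'a set) funct" where
  "Idg_functor = \<lparr> omap = Idg, amap = Idg_map \<rparr>"

definition sigma :: "'a ring \<Rightarrow> 'a set \<Rightarrow> 'a set" where
  "sigma S = (\<lambda>I\<in>carrier (ZId S). gcl S I)"

definition CRig_g_hom :: "'a ring \<Rightarrow> 'b ring \<Rightarrow> ('a \<Rightarrow> 'b) set" where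
  "CRig_g_hom S T = {\<phi> \<in> semiring_hom S T.
     (\<forall>J. z_ideal T J \<longrightarrow> z_ideal S {a \<in> carrier S. \<phi> a \<in> J}) \<and>
     (\<forall>J. g_closed T J \<longrightarrow> g_closed S {a \<in> carrier S. \<phi> a \<in> J})}"

text \<open>
  All objects of one category have their carriers inside the same, arbitrary type \<open>'a\<close>, which
  plays the role of a universe.
\<close>

definition CRig_g :: "('a ring, 'a \<Rightarrow> 'a) cat" where
  "CRig_g = \<lparr> Obj = {S. commutative_semiring S \<and> finite_type_g_closure S},
              Hom = CRig_g_hom,
              Idm = (\<lambda>S. \<lambda>a\<in>carrier S. a),
              Cmp = (\<lambda>S T U \<psi> \<phi>. compose (carrier S) \<psi> \<phi>) \<rparr>"

definition CRig_g_sigma :: "('a ring, 'a \<Rightarrow> 'a) cat" where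
  "CRig_g_sigma = \<lparr> Obj = {S \<in> Obj CRig_g. sigma S \<in> coherent_frame_hom (ZId S) (Idg S)},
                    Hom = (\<lambda>S T. {\<phi> \<in> Hom CRig_g S T. \<forall>a\<in>carrier S.
                             Idg_map S T \<phi> (gcl S (zprinc S a)) = gcl T (zprinc T (\<phi> a))}),
                    Idm = Idm CRig_g,
                    Cmp = Cmp CRig_g \<rparr>"

end

(*
  Both z-ideals and g-closed ideals are the fixed points of a finitary closure operator cl on
  subsets of the semiring with cl A \<inter> cl B = cl {a b | a \<in> A, b \<in> B}.  Every such closure system is
  a coherent frame whose compact elements are the closures of finite sets, and a homomorphism that
  pulls closed ideals back to closed ideals induces a coherent frame homomorphism I \<mapsto> cl (\<phi> ` I),
  left adjoint to the preimage map.  Naturality is then formal: a z-ideal I is the join of the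
  \<langle>a\<rangle>_z with a \<in> I, all maps involved preserve joins, and on \<langle>a\<rangle>_z the square commutes by the
  condition imposed on the morphisms.
*)

theory Submission
  imports Defs
begin

section \<open>Ideals of commutative semirings\<close>

text \<open>The closure operators are applied to arbitrary subsets of the semiring: finite sets,
  images, sets of products. This loses nothing because only ideals are ever compared with these
  sets: an ideal contains an ideal sum iff it contains the union, and a generated ideal iff it
  contains the generators. Hence the joins of principal closures that define the functors collapse
  to the closure of the image of I under \<phi>.

  The product law has two unrelated sources. For z-ideals it comes from maximal ideals being prime,
  which has to be shown without subtraction. For g-closed ideals no property of maximal congruences
  is used for it: (G4) is the law for single elements, the distributivity in (G2) spreads it to
  sets, and finitariness is read off from the compactness of principal closures supplied by (G3).

  Being a natural transformation includes that the source is a category. That the condition on its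
  arrows survives composition rests on the functoriality of extension, so the calculus of extensions
  has to come before the category laws.\<close>

locale csemiring = semiring S + comm_monoid S for S :: "'a ring" (structure)

lemma csemiring_iff: "csemiring S \<longleftrightarrow> commutative_semiring S"
  by (simp add: csemiring_def commutative_semiring_def)

context csemiring
begin

lemma ideal_subset: "semiring_ideal S I \<Longrightarrow> I \<subseteq> carrier S"
  by (simp add: semiring_ideal_def)

lemma ideal_add: "semiring_ideal S I \<Longrightarrow> a \<in> I \<Longrightarrow> b \<in> I \<Longrightarrow> a \<oplus> b \<in> I"
  by (simp add: semiring_ideal_def)

lemma ideal_mult_left: "semiring_ideal S I \<Longrightarrow> a \<in> I \<Longrightarrow> s \<in> carrier S \<Longrightarrow> s \<otimes> a \<in> I"
  by (simp add: semiring_ideal_def)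

lemma ideal_mult_right:
  assumes "semiring_ideal S I" "a \<in> I" "s \<in> carrier S" shows "a \<otimes> s \<in> I"
  using ideal_mult_left[OF assms] m_comm[of a s] ideal_subset[OF assms(1)] assms by auto

lemma ideal_zero:
  assumes "semiring_ideal S I" shows "\<zero> \<in> I"
proof -
  obtain a where "a \<in> I" using assms by (auto simp: semiring_ideal_def)
  then show ?thesis
    using ideal_mult_left[OF assms, of a \<zero>] ideal_subset[OF assms] by auto
qed

lemma ideal_one:
  assumes "semiring_ideal S I" "\<one> \<in> I" shows "I = carrier S"
  using ideal_subset[OF assms(1)] ideal_mult_left[OF assms] by auto

lemma ideal_carrier: "semiring_ideal S (carrier S)"
  by (auto simp: semiring_ideal_def)

lemma ideal_Inter:
  assumes "\<I> \<noteq> {}" "\<And>I. I \<in> \<I> \<Longrightarrow> semiring_ideal S I"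
  shows "semiring_ideal S (\<Inter>\<I>)"
proof -
  have "\<zero> \<in> \<Inter>\<I>" using assms(2) by (auto intro: ideal_zero)
  moreover have "\<Inter>\<I> \<subseteq> carrier S" using assms ideal_subset by auto
  ultimately show ?thesis
    unfolding semiring_ideal_def using assms(2) by (auto intro: ideal_add ideal_mult_left)
qed

lemma ideal_finsum:
  assumes "semiring_ideal S J" "finite F" "\<And>i. i \<in> F \<Longrightarrow> x i \<in> J"
  shows "finsum S x F \<in> J"
  using assms(2,3)
proof (induction F rule: finite_induct)
  case empty
  then show ?case by (simp add: ideal_zero[OF assms(1)])
next
  case (insert i F)
  moreover have "finsum S x (insert i F) = x i \<oplus> finsum S x F"
    using insert ideal_subset[OF assms(1)] by (intro finsum_insert) auto
  ultimately show ?case by (simp add: ideal_add[OF assms(1)])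
qed

text \<open>Ideals cannot distinguish a sum from a union. This removes \<open>ideal_sum\<close> from
  every join below.\<close>

lemma ideal_sum_subset_iff:
  assumes J: "semiring_ideal S J" and "\<And>I. I \<in> \<I> \<Longrightarrow> I \<subseteq> carrier S"
  shows "ideal_sum S \<I> \<subseteq> J \<longleftrightarrow> \<Union>\<I> \<subseteq> J"
proof
  assume *: "ideal_sum S \<I> \<subseteq> J"
  show "\<Union>\<I> \<subseteq> J"
  proof clarify
    fix I a assume "I \<in> \<I>" "a \<in> I"
    \<comment> \<open>An element of one member of the family is a sum with a single summand.\<close>
    then have "finsum S (\<lambda>_. a) {I} \<in> ideal_sum S \<I>"
      unfolding ideal_sum_def by (intro CollectI exI[of _ "\<lambda>_. a"] exI[of _ "{I}"]) auto
    moreover have "finsum S (\<lambda>_. a) {I} = a"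
      using assms(2)[OF \<open>I \<in> \<I>\<close>] \<open>a \<in> I\<close> by auto
    ultimately show "a \<in> J" using * by auto
  qed
next
  assume "\<Union>\<I> \<subseteq> J"
  show "ideal_sum S \<I> \<subseteq> J"
  proof
    fix y assume "y \<in> ideal_sum S \<I>"
    then obtain x F where *: "y = finsum S x F" "finite F" "F \<subseteq> \<I>" "x \<in> (\<Pi> I\<in>F. I)"
      by (auto simp: ideal_sum_def)
    then have "x I \<in> J" if "I \<in> F" for I
      using that \<open>\<Union>\<I> \<subseteq> J\<close> by (blast dest: Pi_mem)
    then show "y \<in> J" unfolding *(1) by (intro ideal_finsum[OF J *(2)])
  qed
qed

lemma ideal_gen_subset_iff:
  "semiring_ideal S J \<Longrightarrow> ideal_gen S A \<subseteq> J \<longleftrightarrow> A \<subseteq> J"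
  by (auto simp: ideal_gen_def)

text \<open>The quotient field of ring theory is not at hand, so maximality is used through
  representations of 1 as m + s c with m in M.\<close>

lemma maximal_ideal_prime:
  assumes M: "maximal_ideal S M" and ab: "a \<in> carrier S" "b \<in> carrier S"
  shows "a \<otimes> b \<in> M \<longleftrightarrow> a \<in> M \<or> b \<in> M"
proof
  have I: "semiring_ideal S M" using M by (simp add: maximal_ideal_def)
  note MS = ideal_subset[OF I]
  \<comment> \<open>For c outside M, the ideal M + S c is strictly larger than M, hence everything,
    and so it contains 1.\<close>
  have inv: "\<exists>m\<in>M. \<exists>s\<in>carrier S. \<one> = m \<oplus> s \<otimes> c" if c: "c \<in> carrier S" "c \<notin> M" for c
  proof -
    let ?J = "{m \<oplus> s \<otimes> c | m s. m \<in> M \<and> s \<in> carrier S}"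
    have "semiring_ideal S ?J"
      unfolding semiring_ideal_def
    proof (intro conjI ballI)
      show "?J \<subseteq> carrier S" using MS c by auto
      show "?J \<noteq> {}" using ideal_zero[OF I] by auto
    next
      fix x y assume "x \<in> ?J" "y \<in> ?J"
      then obtain m s n t where *: "m \<in> M" "s \<in> carrier S" "n \<in> M" "t \<in> carrier S"
        "x = m \<oplus> s \<otimes> c" "y = n \<oplus> t \<otimes> c" by auto
      then have "m \<in> carrier S" "n \<in> carrier S" using MS by auto
      then have "x \<oplus> y = (m \<oplus> n) \<oplus> (s \<oplus> t) \<otimes> c"
        using * c by (simp add: l_distr a_ac)
      then show "x \<oplus> y \<in> ?J" using * ideal_add[OF I] by blast
    next
      fix r x assume r: "r \<in> carrier S" and "x \<in> ?J"
      then obtain m s where *: "m \<in> M" "s \<in> carrier S" "x = m \<oplus> s \<otimes> c" by auto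
      then have "m \<in> carrier S" using MS by auto
      then have "r \<otimes> x = r \<otimes> m \<oplus> (r \<otimes> s) \<otimes> c"
        using * c r by (simp add: r_distr m_assoc)
      then show "r \<otimes> x \<in> ?J" using * r ideal_mult_left[OF I] by blast
    qed
    moreover have "M \<subseteq> ?J"
    proof
      fix m assume "m \<in> M"
      then have "m = m \<oplus> \<zero> \<otimes> c" using MS c by auto
      then show "m \<in> ?J" using \<open>m \<in> M\<close> by blast
    qed
    moreover have "?J \<noteq> M"
    proof -
      have "c = \<zero> \<oplus> \<one> \<otimes> c" using c by simp
      then have "c \<in> ?J" using ideal_zero[OF I] by blast
      then show ?thesis using c by auto
    qed
    ultimately have "?J = carrier S" using M unfolding maximal_ideal_def by blast
    then have "\<one> \<in> ?J" by simp
    then show ?thesis by blast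
  qed
  assume abM: "a \<otimes> b \<in> M"
  show "a \<in> M \<or> b \<in> M"
  proof (rule ccontr)
    assume "\<not> (a \<in> M \<or> b \<in> M)"
    then obtain m s n t where *: "m \<in> M" "s \<in> carrier S" "\<one> = m \<oplus> s \<otimes> a"
      "n \<in> M" "t \<in> carrier S" "\<one> = n \<oplus> t \<otimes> b"
      using inv[OF ab(1)] inv[OF ab(2)] by blast
    have mn: "m \<in> carrier S" "n \<in> carrier S" using * MS by auto
    \<comment> \<open>Expand 1 = (m + s a)(n + t b). Every term lies in M, the product of s a and t
      b because a b does; thus 1 would lie in M.\<close>
    have "(s \<otimes> a) \<otimes> (t \<otimes> b) = (s \<otimes> t) \<otimes> (a \<otimes> b)"
      using * ab by (simp add: m_ac)
    then have "(s \<otimes> a) \<otimes> (t \<otimes> b) \<in> M"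
      using *(2,5) ideal_mult_left[OF I abM] by simp
    then have "(s \<otimes> a) \<otimes> (n \<oplus> t \<otimes> b) \<in> M"
      using *(1,2,4,5) mn ab by (simp add: r_distr ideal_add[OF I] ideal_mult_left[OF I])
    moreover have "m \<otimes> (n \<oplus> t \<otimes> b) \<in> M"
      using *(1,5) mn ab by (intro ideal_mult_right[OF I]) auto
    ultimately have "(m \<oplus> s \<otimes> a) \<otimes> (n \<oplus> t \<otimes> b) \<in> M"
      using *(2,5) mn ab by (simp add: l_distr ideal_add[OF I])
    then have "\<one> \<otimes> \<one> \<in> M" unfolding *(3)[symmetric] *(6)[symmetric] .
    then have "\<one> \<in> M" by simp
    then show False using ideal_one[OF I] M by (simp add: maximal_ideal_def)
  qed
next
  have I: "semiring_ideal S M" using M by (simp add: maximal_ideal_def)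
  assume "a \<in> M \<or> b \<in> M"
  then show "a \<otimes> b \<in> M"
    using ab ideal_mult_left[OF I] ideal_mult_right[OF I] by auto
qed

text \<open>Two consequences are used later: multiplying by b respects lying in the same maximal
  ideals, and x and its square lie in the same maximal ideals, so z-ideals are radical.\<close>

lemma max_ideals_at_mult:
  "a \<in> carrier S \<Longrightarrow> b \<in> carrier S \<Longrightarrow>
    max_ideals_at S (a \<otimes> b) = max_ideals_at S a \<union> max_ideals_at S b"
  by (auto simp: max_ideals_at_def maximal_ideal_prime)

section \<open>Zero classes of congruences and the operator \<open>gcl\<close>\<close>

lemma zero_class_ideal:
  assumes "semiring_congruence S \<theta>" shows "semiring_ideal S (zero_class S \<theta>)"
proof -
  have eq: "equiv (carrier S) \<theta>"
    and add: "\<And>a b c d. (a, b) \<in> \<theta> \<Longrightarrow> (c, d) \<in> \<theta> \<Longrightarrow> (a \<oplus> c, b \<oplus> d) \<in> \<theta>"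
    and mult: "\<And>a b c d. (a, b) \<in> \<theta> \<Longrightarrow> (c, d) \<in> \<theta> \<Longrightarrow> (a \<otimes> c, b \<otimes> d) \<in> \<theta>"
    using assms by (auto simp: semiring_congruence_def)
  have refl: "(s, s) \<in> \<theta>" if "s \<in> carrier S" for s
    using eq that by (auto simp: equiv_def dest: refl_onD)
  have sub: "\<theta> \<subseteq> carrier S \<times> carrier S"
    using eq by (rule equiv_type)
  show ?thesis
    unfolding semiring_ideal_def zero_class_def
  proof (intro conjI ballI)
    show "{a. (a, \<zero>) \<in> \<theta>} \<noteq> {}" using refl[of \<zero>] by auto
    show "{a. (a, \<zero>) \<in> \<theta>} \<subseteq> carrier S" using sub by auto
    show "a \<oplus> b \<in> {a. (a, \<zero>) \<in> \<theta>}" if "a \<in> {a. (a, \<zero>) \<in> \<theta>}" "b \<in> {a. (a, \<zero>) \<in> \<theta>}" for a b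
      using add[of a \<zero> b \<zero>] that by simp
    show "s \<otimes> a \<in> {a. (a, \<zero>) \<in> \<theta>}" if "s \<in> carrier S" "a \<in> {a. (a, \<zero>) \<in> \<theta>}" for s a
      using mult[of s s a \<zero>] that refl by simp
  qed
qed

text \<open>Presents \<open>gcl S I\<close> as an intersection of zero classes of maximal
  congruences, the form from which all closure properties are read off.\<close>

lemma mem_gcl_iff:
  "a \<in> gcl S I \<longleftrightarrow> a \<in> carrier S \<and>
    (\<forall>\<theta>. maximal_congruence S \<theta> \<longrightarrow> I \<subseteq> zero_class S \<theta> \<longrightarrow> a \<in> zero_class S \<theta>)"
  by (auto simp: gcl_def wp_def zero_class_def)

lemma gcl_ideal: "semiring_ideal S (gcl S I)"
proof -
  have *: "semiring_ideal S (zero_class S \<theta>)" if "maximal_congruence S \<theta>" for \<theta>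
    using that by (auto simp: maximal_congruence_def intro: zero_class_ideal)
  have "\<zero> \<in> gcl S I"
    by (simp add: mem_gcl_iff ideal_zero[OF *])
  then have "gcl S I \<noteq> {}" by blast
  then show ?thesis
    unfolding semiring_ideal_def
    by (auto simp: mem_gcl_iff intro: ideal_add[OF *] ideal_mult_left[OF *])
qed

lemma gcl_mono: "I \<subseteq> J \<Longrightarrow> gcl S I \<subseteq> gcl S J"
  by (auto simp: mem_gcl_iff)

lemma gcl_extensive: "I \<subseteq> carrier S \<Longrightarrow> I \<subseteq> gcl S I"
  by (auto simp: mem_gcl_iff)

lemma gcl_idem:
  assumes "I \<subseteq> carrier S" shows "gcl S (gcl S I) = gcl S I"
proof -
  \<comment> \<open>A maximal congruence qualifies for the closure of I exactly when it qualifies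
    for I.\<close>
  have "gcl S I \<subseteq> zero_class S \<theta> \<longleftrightarrow> I \<subseteq> zero_class S \<theta>" if "maximal_congruence S \<theta>" for \<theta>
    using that gcl_extensive[OF assms] by (auto simp: mem_gcl_iff)
  then show ?thesis by (auto simp: mem_gcl_iff[of _ "gcl S I"] mem_gcl_iff[of _ I])
qed

lemma gcl_closed: "I \<subseteq> carrier S \<Longrightarrow> g_closed S (gcl S I)"
  by (simp add: g_closed_def gcl_ideal gcl_idem)

text \<open>Zero classes are ideals, so \<open>gcl\<close> sees a set only through the ideals above
  it. Generated ideals and ideal sums may therefore be replaced by generators and unions.\<close>

lemma gcl_cong_ideal:
  assumes "\<And>J. semiring_ideal S J \<Longrightarrow> A \<subseteq> J \<longleftrightarrow> B \<subseteq> J"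
  shows "gcl S A = gcl S B"
proof -
  have "A \<subseteq> zero_class S \<theta> \<longleftrightarrow> B \<subseteq> zero_class S \<theta>" if "maximal_congruence S \<theta>" for \<theta>
    using assms zero_class_ideal that by (auto simp: maximal_congruence_def)
  then show ?thesis by (auto simp: mem_gcl_iff)
qed

lemma zcl_cong_ideal:
  assumes "\<And>J. semiring_ideal S J \<Longrightarrow> A \<subseteq> J \<longleftrightarrow> B \<subseteq> J"
  shows "zcl S A = zcl S B"
proof -
  have "{J. z_ideal S J \<and> A \<subseteq> J} = {J. z_ideal S J \<and> B \<subseteq> J}"
    using assms by (auto simp: z_ideal_def)
  then show ?thesis by (simp add: zcl_def)
qed

end


section \<open>Closure systems of ideals\<close>

text \<open>\<open>cl\<close> is a parameter so that \<open>zcl\<close> and \<open>gcl\<close> can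
  be inserted literally. Its equation is demanded only inside the carrier: for a set that leaves the
  carrier the intersection is indexed by the empty set and equals \<open>UNIV\<close>, whereas
  \<open>gcl\<close> always stays in the carrier.\<close>

locale ideal_closure = csemiring S for S :: "'a ring" (structure) +
  fixes X :: "'a set set" and cl :: "'a set \<Rightarrow> 'a set"
  assumes closed_ideal: "I \<in> X \<Longrightarrow> semiring_ideal S I"
    and carrier_closed: "carrier S \<in> X"
    and Inter_closed: "\<I> \<subseteq> X \<Longrightarrow> \<I> \<noteq> {} \<Longrightarrow> \<Inter>\<I> \<in> X"
    and cl_eq: "A \<subseteq> carrier S \<Longrightarrow> cl A = \<Inter>{J \<in> X. A \<subseteq> J}"
begin

lemma closed_subset: "I \<in> X \<Longrightarrow> I \<subseteq> carrier S"
  using closed_ideal ideal_subset by blast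

lemma cl_closed: "A \<subseteq> carrier S \<Longrightarrow> cl A \<in> X"
  using carrier_closed by (auto simp: cl_eq intro!: Inter_closed)

lemma cl_subset_iff: "A \<subseteq> carrier S \<Longrightarrow> J \<in> X \<Longrightarrow> cl A \<subseteq> J \<longleftrightarrow> A \<subseteq> J"
  by (auto simp: cl_eq)

lemma cl_extensive: "A \<subseteq> carrier S \<Longrightarrow> A \<subseteq> cl A"
  by (auto simp: cl_eq)

lemma cl_in_carrier: "A \<subseteq> carrier S \<Longrightarrow> cl A \<subseteq> carrier S"
  by (simp add: cl_closed closed_subset)

lemma cl_mono: "A \<subseteq> B \<Longrightarrow> B \<subseteq> carrier S \<Longrightarrow> cl A \<subseteq> cl B"
  using cl_extensive[of B] by (simp add: cl_subset_iff cl_closed)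

lemma cl_id: "I \<in> X \<Longrightarrow> cl I = I"
  using closed_subset[of I] cl_extensive[of I] by (simp add: subset_antisym cl_subset_iff)

lemma cl_subset_cl_iff: "A \<subseteq> carrier S \<Longrightarrow> B \<subseteq> carrier S \<Longrightarrow> cl A \<subseteq> cl B \<longleftrightarrow> A \<subseteq> cl B"
  by (simp add: cl_subset_iff cl_closed)

lemma cl_eqI:
  assumes "A \<subseteq> carrier S" "B \<subseteq> carrier S" "\<And>J. J \<in> X \<Longrightarrow> A \<subseteq> J \<longleftrightarrow> B \<subseteq> J"
  shows "cl A = cl B"
proof -
  have "{J \<in> X. A \<subseteq> J} = {J \<in> X. B \<subseteq> J}" using assms(3) by auto
  then show ?thesis using assms(1,2) by (simp add: cl_eq)
qed

lemma Int_closed: "I \<in> X \<Longrightarrow> J \<in> X \<Longrightarrow> I \<inter> J \<in> X"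
  using Inter_closed[of "{I, J}"] by simp

lemma Union_in_carrier: "\<I> \<subseteq> X \<Longrightarrow> \<Union>\<I> \<subseteq> carrier S"
  using closed_subset by blast

text \<open>A closed ideal contains the closure of A iff it contains A, so inner closures disappear
  under an outer one.\<close>

lemma cl_Union_cl:
  assumes "\<And>A. A \<in> \<A> \<Longrightarrow> A \<subseteq> carrier S"
  shows "cl (\<Union>(cl ` \<A>)) = cl (\<Union>\<A>)"
proof (rule cl_eqI)
  show "\<Union>(cl ` \<A>) \<subseteq> carrier S" using assms cl_in_carrier by blast
  show "\<Union>\<A> \<subseteq> carrier S" using assms by blast
  show "\<Union>(cl ` \<A>) \<subseteq> J \<longleftrightarrow> \<Union>\<A> \<subseteq> J" if "J \<in> X" for J
    using assms that cl_subset_iff by (simp add: UN_subset_iff Sup_le_iff)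
qed

lemma cl_UN_singletons:
  assumes "A \<subseteq> carrier S"
  shows "cl (\<Union>a\<in>A. cl {a}) = cl A"
  using cl_Union_cl[of "(\<lambda>a. {a}) ` A"] assms by (auto simp: image_image)

section \<open>The complete lattice of closed ideals\<close>

abbreviation L where "L \<equiv> inclusion_order X"

lemma order_simps [simp]:
  "carrier L = X" "I \<sqsubseteq>\<^bsub>L\<^esub> J \<longleftrightarrow> I \<subseteq> J" "(.=\<^bsub>L\<^esub>) = (=)"
  by (simp_all add: inclusion_order_def)

lemma partial_order_L: "partial_order L"
  by unfold_locales auto

lemma sup_least: "\<I> \<subseteq> X \<Longrightarrow> least L (cl (\<Union>\<I>)) (Upper L \<I>)"
  using Union_in_carrier[of \<I>] cl_extensive[of "\<Union>\<I>"] cl_subset_iff[of "\<Union>\<I>"]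
  by (auto simp: least_def Upper_def cl_closed)

text \<open>Intersecting with the carrier covers the empty family, whose intersection is
  \<open>UNIV\<close>.\<close>

lemma inf_greatest: "\<I> \<subseteq> X \<Longrightarrow> greatest L (carrier S \<inter> \<Inter>\<I>) (Lower L \<I>)"
  using Inter_closed[of "insert (carrier S) \<I>"] carrier_closed closed_subset
  by (auto simp: greatest_def Lower_def)

lemma complete_lattice_L: "complete_lattice L"
proof -
  interpret partial_order L by (rule partial_order_L)
  show ?thesis
    by unfold_locales (metis order_simps(1) sup_least, metis order_simps(1) inf_greatest)
qed

sublocale lat: complete_lattice L
  by (rule complete_lattice_L)

text \<open>\<open>sup\<close> selects a least upper bound by \<open>SOME\<close>; its value is
  determined because least elements are unique.\<close>

lemma sup_eq: "\<I> \<subseteq> X \<Longrightarrow> \<Squnion>\<^bsub>L\<^esub> \<I> = cl (\<Union>\<I>)"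
  unfolding sup_def by (rule some_equality) (use sup_least lat.least_unique in blast)+

lemma meet_eq:
  assumes "I \<in> X" "J \<in> X" shows "I \<sqinter>\<^bsub>L\<^esub> J = I \<inter> J"
proof -
  have *: "greatest L (I \<inter> J) (Lower L {I, J})"
    using inf_greatest[of "{I, J}"] assms closed_subset by (simp add: Int_absorb1 le_infI1)
  then show ?thesis
    unfolding meet_def inf_def by (rule some_equality) (use * lat.greatest_unique in blast)
qed

lemma top_eq: "\<top>\<^bsub>L\<^esub> = carrier S"
proof
  show "\<top>\<^bsub>L\<^esub> \<subseteq> carrier S" using lat.top_closed by (intro closed_subset) simp
  show "carrier S \<subseteq> \<top>\<^bsub>L\<^esub>" using lat.top_higher[of "carrier S"] carrier_closed by simp
qed

end

text \<open>
  The law \<open>cl_mult\<close> packages frame distributivity together with \<open>\<langle>a\<rangle> \<inter> \<langle>b\<rangle> = \<langle>ab\<rangle>\<close>.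
\<close>

locale finitary_mult_closure = ideal_closure +
  assumes cl_finitary: "A \<subseteq> carrier S \<Longrightarrow> a \<in> cl A \<Longrightarrow> \<exists>F. finite F \<and> F \<subseteq> A \<and> a \<in> cl F"
    and cl_mult: "A \<subseteq> carrier S \<Longrightarrow> B \<subseteq> carrier S \<Longrightarrow>
      cl A \<inter> cl B = cl {a \<otimes> b | a b. a \<in> A \<and> b \<in> B}"
begin

lemma cl_finitary_finite:
  assumes "A \<subseteq> carrier S" "finite E" "E \<subseteq> cl A"
  shows "\<exists>F. finite F \<and> F \<subseteq> A \<and> E \<subseteq> cl F"
  using assms(2,3)
proof (induction E rule: finite_induct)
  case empty
  then show ?case by auto
next
  case (insert a E)
  then obtain F where F: "finite F" "F \<subseteq> A" "E \<subseteq> cl F" by blast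
  obtain G where G: "finite G" "G \<subseteq> A" "a \<in> cl G"
    using cl_finitary[OF assms(1), of a] insert.prems by blast
  have FG: "F \<union> G \<subseteq> carrier S" using F(2) G(2) assms(1) by blast
  have "E \<subseteq> cl (F \<union> G)" "a \<in> cl (F \<union> G)"
    using cl_mono[OF Un_upper1 FG] cl_mono[OF Un_upper2 FG] F(3) G(3) by blast+
  then have "insert a E \<subseteq> cl (F \<union> G)" by simp
  moreover have "finite (F \<union> G)" "F \<union> G \<subseteq> A" using F G by simp_all
  ultimately show ?case by blast
qed

text \<open>By \<open>cl_mult\<close>, the left side is the closure of the products a b with a in I
  and b in some member J of the family. Such a product lies in the intersection of I and J, which
  gives the nontrivial inclusion.\<close>

lemma is_frame_L: "is_frame L"
  unfolding is_frame_def
proof (intro conjI ballI allI impI complete_lattice_L)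
  fix I \<I> assume I: "I \<in> carrier L" and \<I>: "\<I> \<subseteq> carrier L"
  let ?\<K> = "(\<lambda>J. I \<sqinter>\<^bsub>L\<^esub> J) ` \<I>"
  have K: "?\<K> = (\<lambda>J. I \<inter> J) ` \<I>"
    using I \<I> by (intro image_cong) (auto intro!: meet_eq)
  have KX: "?\<K> \<subseteq> X"
    using I \<I> Int_closed unfolding K by auto
  have carr: "\<Union>\<I> \<subseteq> carrier S" "I \<subseteq> carrier S" "\<Union>?\<K> \<subseteq> carrier S"
    using Union_in_carrier[OF \<I>[unfolded order_simps]] closed_subset[OF I[unfolded order_simps]]
      Union_in_carrier[OF KX] by this
  let ?P = "{a \<otimes> b | a b. a \<in> I \<and> b \<in> \<Union>\<I>}"
  have P: "?P \<subseteq> \<Union>?\<K>"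
  proof clarify
    fix a b J assume *: "a \<in> I" "b \<in> J" "J \<in> \<I>"
    then have "a \<in> carrier S" "b \<in> carrier S" "I \<in> X" "J \<in> X" using I \<I> carr by auto
    then have "a \<otimes> b \<in> I" "a \<otimes> b \<in> J"
      using * by (auto intro: ideal_mult_right[OF closed_ideal] ideal_mult_left[OF closed_ideal])
    then show "a \<otimes> b \<in> \<Union>?\<K>" using * unfolding K by auto
  qed
  have IP: "I \<inter> cl (\<Union>\<I>) = cl ?P"
    using cl_mult[OF carr(2,1)] I by (simp add: cl_id)
  have "\<Union>?\<K> \<subseteq> I \<inter> cl (\<Union>\<I>)"
    using cl_extensive[OF carr(1)] unfolding K by auto
  then have "cl (\<Union>?\<K>) \<subseteq> cl ?P"
    using cl_subset_cl_iff[OF carr(3)] P carr(3) unfolding IP by blast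
  then have "cl ?P = cl (\<Union>?\<K>)"
    using cl_mono[OF P carr(3)] by blast
  moreover have "I \<sqinter>\<^bsub>L\<^esub> \<Squnion>\<^bsub>L\<^esub> \<I> = I \<inter> cl (\<Union>\<I>)"
    using I \<I> carr(1) by (simp add: meet_eq sup_eq cl_closed)
  ultimately show "I \<sqinter>\<^bsub>L\<^esub> \<Squnion>\<^bsub>L\<^esub> \<I> = \<Squnion>\<^bsub>L\<^esub> ?\<K>"
    using sup_eq[OF KX] IP by simp
qed

lemma compacts_eq: "compacts L = {cl A | A. finite A \<and> A \<subseteq> carrier S}"
proof (intro equalityI subsetI)
  fix K assume "K \<in> compacts L"
  then have K: "K \<in> X" and compact: "\<And>\<I>. \<I> \<subseteq> X \<Longrightarrow> K \<subseteq> \<Squnion>\<^bsub>L\<^esub> \<I> \<Longrightarrow>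
      \<exists>\<F>. finite \<F> \<and> \<F> \<subseteq> \<I> \<and> K \<subseteq> \<Squnion>\<^bsub>L\<^esub> \<F>"
    by (auto simp: compacts_def)
  note KS = closed_subset[OF K]
  have X: "(\<lambda>a. cl {a}) ` B \<subseteq> X" if "B \<subseteq> K" for B
    using KS that by (auto intro!: cl_closed)
  have sup: "\<Squnion>\<^bsub>L\<^esub> ((\<lambda>a. cl {a}) ` B) = cl B" if "B \<subseteq> K" for B
    using KS that by (simp add: sup_eq[OF X] cl_UN_singletons)
  \<comment> \<open>Compactness is applied to the cover of K by the principal closures of its own
    elements.\<close>
  obtain \<F> where \<F>: "finite \<F>" "\<F> \<subseteq> (\<lambda>a. cl {a}) ` K" "K \<subseteq> \<Squnion>\<^bsub>L\<^esub> \<F>"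
    using compact[OF X[OF subset_refl]] by (auto simp: sup cl_id K)
  obtain B where B: "finite B" "B \<subseteq> K" "\<F> = (\<lambda>a. cl {a}) ` B"
    using finite_subset_image[OF \<F>(1,2)] by auto
  have "K \<subseteq> cl B" using \<F> sup B by simp
  moreover have "cl B \<subseteq> K" using B K KS by (subst cl_subset_iff) auto
  ultimately have "K = cl B" by blast
  then show "K \<in> {cl A | A. finite A \<and> A \<subseteq> carrier S}" using B(1,2) KS by blast
next
  fix K assume "K \<in> {cl A | A. finite A \<and> A \<subseteq> carrier S}"
  then obtain A where A: "finite A" "A \<subseteq> carrier S" "K = cl A" by auto
  have "\<exists>\<F>. finite \<F> \<and> \<F> \<subseteq> \<I> \<and> K \<subseteq> \<Squnion>\<^bsub>L\<^esub> \<F>" if \<I>: "\<I> \<subseteq> X" "K \<subseteq> \<Squnion>\<^bsub>L\<^esub> \<I>" for \<I>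
  proof -
    note U = Union_in_carrier[OF \<I>(1)]
    have "A \<subseteq> cl (\<Union>\<I>)" using \<I> A cl_extensive[of A] by (simp add: sup_eq)
    then obtain F where F: "finite F" "F \<subseteq> \<Union>\<I>" "A \<subseteq> cl F"
      using cl_finitary_finite[OF U A(1)] by auto
    then obtain \<F> where \<F>: "finite \<F>" "\<F> \<subseteq> \<I>" "F \<subseteq> \<Union>\<F>"
      by (meson finite_subset_Union)
    have "\<Union>\<F> \<subseteq> carrier S" using \<F> U by auto
    then have "K \<subseteq> cl (\<Union>\<F>)"
      using A(2,3) F(3) \<F>(3) cl_mono[of F "\<Union>\<F>"] cl_subset_cl_iff[of A "\<Union>\<F>"] by blast
    moreover have "\<Squnion>\<^bsub>L\<^esub> \<F> = cl (\<Union>\<F>)" using \<F>(2) \<I>(1) by (intro sup_eq) blast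
    ultimately show ?thesis using \<F>(1,2) by metis
  qed
  moreover have "K \<in> X" using A by (simp add: cl_closed)
  ultimately show "K \<in> compacts L" unfolding compacts_def by simp
qed

lemma coherent_frame_L: "coherent_frame L"
  unfolding coherent_frame_def
proof (intro conjI ballI is_frame_L)
  \<comment> \<open>The top is the closure of a single element, hence compact.\<close>
  have "cl {\<one>} = carrier S"
    using cl_extensive[of "{\<one>}"] by (intro ideal_one closed_ideal cl_closed) auto
  then show "\<top>\<^bsub>L\<^esub> \<in> compacts L"
    unfolding top_eq compacts_eq by (intro CollectI exI[of _ "{\<one>}"]) simp
next
  fix I assume I: "I \<in> carrier L"
  then have IS: "I \<subseteq> carrier S" by (simp add: closed_subset)
  show "\<exists>K \<subseteq> compacts L. I = \<Squnion>\<^bsub>L\<^esub> K"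
  proof (intro exI conjI)
    show "(\<lambda>a. cl {a}) ` I \<subseteq> compacts L" using IS by (auto simp: compacts_eq)
    have "\<Squnion>\<^bsub>L\<^esub> ((\<lambda>a. cl {a}) ` I) = cl (\<Union>a\<in>I. cl {a})"
      using IS by (intro sup_eq) (auto intro!: cl_closed)
    then show "I = \<Squnion>\<^bsub>L\<^esub> ((\<lambda>a. cl {a}) ` I)"
      using I IS by (simp add: cl_UN_singletons cl_id)
  qed
next
  fix K J assume "K \<in> compacts L" "J \<in> compacts L"
  then obtain A B where *: "finite A" "A \<subseteq> carrier S" "K = cl A" "finite B" "B \<subseteq> carrier S" "J = cl B"
    by (auto simp: compacts_eq)
  let ?C = "(\<lambda>(a, b). a \<otimes> b) ` (A \<times> B)"
  \<comment> \<open>By \<open>cl_mult\<close>, the products of two finite generating sets generate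
    the meet, and there are finitely many of them.\<close>
  have "{a \<otimes> b | a b. a \<in> A \<and> b \<in> B} = ?C" by auto
  then have "K \<sqinter>\<^bsub>L\<^esub> J = cl ?C"
    using * by (simp add: meet_eq cl_closed cl_mult)
  moreover have "finite ?C" "?C \<subseteq> carrier S" using * by auto
  ultimately show "K \<sqinter>\<^bsub>L\<^esub> J \<in> compacts L"
    unfolding compacts_eq by (intro CollectI exI[of _ ?C]) simp
qed

end


section \<open>Extension of closed ideals along homomorphisms\<close>

text \<open>\<open>cl\<close> is the closure of the target. The restriction to \<open>X\<close>
  matches the extensional arrows of \<open>CohFrm\<close>.\<close>

definition extension :: "'a set set \<Rightarrow> ('b set \<Rightarrow> 'b set) \<Rightarrow> ('a \<Rightarrow> 'b) \<Rightarrow> 'a set \<Rightarrow> 'b set" where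
  "extension X cl \<phi> = (\<lambda>I\<in>X. cl (\<phi> ` I))"

locale closure_hom = S: finitary_mult_closure S X cl + T: finitary_mult_closure T Y cl'
  for S :: "'a ring" and X cl and T :: "'b ring" and Y cl' +
  fixes \<phi> :: "'a \<Rightarrow> 'b"
  assumes hom: "\<phi> \<in> semiring_hom S T"
    and preimage_closed: "J \<in> Y \<Longrightarrow> {a \<in> carrier S. \<phi> a \<in> J} \<in> X"
begin

lemma image_in_carrier: "A \<subseteq> carrier S \<Longrightarrow> \<phi> ` A \<subseteq> carrier T"
  using hom by (auto simp: semiring_hom_def ring_hom_closed)

lemma extension_closed: "I \<in> X \<Longrightarrow> extension X cl' \<phi> I \<in> Y"
  by (simp add: extension_def T.cl_closed image_in_carrier S.closed_subset)

text \<open>For closed J, the preimage of J is closed, so it contains A iff it contains the closure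
  of A. Extension can thus be computed on generators, which gives preservation of joins and of
  compact elements and compatibility with composition.\<close>

lemma extension_cl:
  assumes A: "A \<subseteq> carrier S" shows "extension X cl' \<phi> (cl A) = cl' (\<phi> ` A)"
proof -
  have "\<phi> ` cl A \<subseteq> J \<longleftrightarrow> \<phi> ` A \<subseteq> J" if "J \<in> Y" for J
    using S.cl_subset_iff[OF A preimage_closed[OF that]] A S.cl_in_carrier[OF A] by auto
  then have "cl' (\<phi> ` cl A) = cl' (\<phi> ` A)"
    using A by (intro T.cl_eqI image_in_carrier S.cl_in_carrier)
  then show ?thesis using A by (simp add: extension_def S.cl_closed)
qed

lemma extension_sup:
  assumes \<I>: "\<I> \<subseteq> X"
  shows "extension X cl' \<phi> (\<Squnion>\<^bsub>S.L\<^esub> \<I>) = \<Squnion>\<^bsub>T.L\<^esub> (extension X cl' \<phi> ` \<I>)"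
proof -
  have "extension X cl' \<phi> ` \<I> = cl' ` (`) \<phi> ` \<I>"
    using \<I> by (auto simp: extension_def image_image intro!: image_cong)
  moreover have "extension X cl' \<phi> ` \<I> \<subseteq> Y"
    using \<I> extension_closed by auto
  moreover have "cl' (\<Union>(cl' ` (`) \<phi> ` \<I>)) = cl' (\<Union>((`) \<phi> ` \<I>))"
    using \<I> image_in_carrier S.closed_subset by (intro T.cl_Union_cl) blast
  ultimately have "\<Squnion>\<^bsub>T.L\<^esub> (extension X cl' \<phi> ` \<I>) = cl' (\<Union>((`) \<phi> ` \<I>))"
    using T.sup_eq by metis
  also have "\<dots> = extension X cl' \<phi> (\<Squnion>\<^bsub>S.L\<^esub> \<I>)"
    using \<I> by (simp add: S.sup_eq extension_cl S.Union_in_carrier image_Union)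
  finally show ?thesis ..
qed

lemma extension_coherent: "extension X cl' \<phi> \<in> coherent_frame_hom S.L T.L"
  unfolding coherent_frame_hom_def frame_hom_def
proof (intro CollectI conjI ballI allI impI)
  show "extension X cl' \<phi> \<in> carrier S.L \<rightarrow>\<^sub>E carrier T.L"
    using extension_closed by (auto simp: extension_def)
next
  \<comment> \<open>The closure of the image is an ideal containing 1, hence the whole
    target.\<close>
  have "\<one>\<^bsub>T\<^esub> \<in> \<phi> ` carrier S"
    using hom by (auto simp: semiring_hom_def ring_hom_one intro!: rev_image_eqI)
  then have "cl' (\<phi> ` carrier S) = carrier T"
    using T.cl_extensive[OF image_in_carrier, OF subset_refl] image_in_carrier
    by (intro T.ideal_one T.closed_ideal T.cl_closed) auto
  then show "extension X cl' \<phi> \<top>\<^bsub>S.L\<^esub> = \<top>\<^bsub>T.L\<^esub>"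
    by (simp add: S.top_eq T.top_eq extension_def S.carrier_closed)
next
  fix I J assume "I \<in> carrier S.L" "J \<in> carrier S.L"
  then have IJ: "I \<in> X" "J \<in> X" by simp_all
  note sub = S.closed_subset[OF IJ(1)] S.closed_subset[OF IJ(2)]
  \<comment> \<open>The product law reduces the meet to products of images. Such a product is the
    image of a b, which lies in both ideals. The other inclusion is monotonicity.\<close>
  have "cl' (\<phi> ` I) \<inter> cl' (\<phi> ` J) = cl' {a \<otimes>\<^bsub>T\<^esub> b | a b. a \<in> \<phi> ` I \<and> b \<in> \<phi> ` J}"
    by (intro T.cl_mult image_in_carrier sub)
  also have "\<dots> \<subseteq> cl' (\<phi> ` (I \<inter> J))"
  proof (intro T.cl_mono image_in_carrier)
    show "{a \<otimes>\<^bsub>T\<^esub> b | a b. a \<in> \<phi> ` I \<and> b \<in> \<phi> ` J} \<subseteq> \<phi> ` (I \<inter> J)"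
    proof clarify
      fix a b assume ab: "a \<in> I" "b \<in> J"
      then have "a \<otimes>\<^bsub>S\<^esub> b \<in> I \<inter> J"
        using IJ sub S.ideal_mult_right[OF S.closed_ideal, of I a b]
          S.ideal_mult_left[OF S.closed_ideal, of J b a]
        by auto
      moreover have "\<phi> (a \<otimes>\<^bsub>S\<^esub> b) = \<phi> a \<otimes>\<^bsub>T\<^esub> \<phi> b"
        using subsetD[OF sub(1) ab(1)] subsetD[OF sub(2) ab(2)] hom
        by (simp add: semiring_hom_def ring_hom_mult)
      ultimately show "\<phi> a \<otimes>\<^bsub>T\<^esub> \<phi> b \<in> \<phi> ` (I \<inter> J)" by (metis imageI)
    qed
  qed (use sub in auto)
  finally have "cl' (\<phi> ` I) \<inter> cl' (\<phi> ` J) \<subseteq> cl' (\<phi> ` (I \<inter> J))" .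
  moreover have "cl' (\<phi> ` (I \<inter> J)) \<subseteq> cl' (\<phi> ` I)" "cl' (\<phi> ` (I \<inter> J)) \<subseteq> cl' (\<phi> ` J)"
    by (intro T.cl_mono image_in_carrier sub image_mono Int_lower1 Int_lower2)+
  ultimately have "cl' (\<phi> ` I) \<inter> cl' (\<phi> ` J) = cl' (\<phi> ` (I \<inter> J))" by blast
  then show "extension X cl' \<phi> (I \<sqinter>\<^bsub>S.L\<^esub> J) = extension X cl' \<phi> I \<sqinter>\<^bsub>T.L\<^esub> extension X cl' \<phi> J"
    using IJ extension_closed
    by (simp add: S.meet_eq T.meet_eq S.Int_closed) (simp add: extension_def S.Int_closed)
next
  show "extension X cl' \<phi> (\<Squnion>\<^bsub>S.L\<^esub> \<I>) = \<Squnion>\<^bsub>T.L\<^esub> (extension X cl' \<phi> ` \<I>)" if "\<I> \<subseteq> carrier S.L" for \<I>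
    using that extension_sup by simp
next
  show "extension X cl' \<phi> ` compacts S.L \<subseteq> compacts T.L"
  proof clarify
    fix K assume "K \<in> compacts S.L"
    then obtain A where A: "finite A" "A \<subseteq> carrier S" "K = cl A"
      unfolding S.compacts_eq by blast
    then have "extension X cl' \<phi> K = cl' (\<phi> ` A)" by (simp add: extension_cl)
    then show "extension X cl' \<phi> K \<in> compacts T.L"
      unfolding T.compacts_eq using A(1) image_in_carrier[OF A(2)] by blast
  qed
qed

end

lemma (in finitary_mult_closure) extension_id:
  "extension X cl (\<lambda>a\<in>carrier S. a) = (\<lambda>I\<in>X. I)"
proof -
  have "(\<lambda>a\<in>carrier S. a) ` I = I" if "I \<in> X" for I
    using closed_subset[OF that] by force
  then show ?thesis
    unfolding extension_def by (intro restrict_ext) (simp only: cl_id mem_Collect_eq)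
qed

text \<open>The intermediate closure is absorbed by \<open>extension_cl\<close> applied to
  \<psi>.\<close>

lemma extension_compose:
  assumes "closure_hom S X cl T Y cl' \<phi>" "closure_hom T Y cl' U Z cl'' \<psi>"
  shows "extension X cl'' (compose (carrier S) \<psi> \<phi>)
    = compose X (extension Y cl'' \<psi>) (extension X cl' \<phi>)"
proof -
  interpret \<phi>: closure_hom S X cl T Y cl' \<phi> by fact
  interpret \<psi>: closure_hom T Y cl' U Z cl'' \<psi> by fact
  have "cl'' (compose (carrier S) \<psi> \<phi> ` I) = extension Y cl'' \<psi> (cl' (\<phi> ` I))" if "I \<in> X" for I
  proof -
    have "compose (carrier S) \<psi> \<phi> ` I = \<psi> ` \<phi> ` I"
      using \<phi>.S.closed_subset[OF that] by (force simp: compose_def)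
    then show ?thesis
      using \<psi>.extension_cl \<phi>.image_in_carrier \<phi>.S.closed_subset that by simp
  qed
  then show ?thesis
    unfolding extension_def[of X] compose_def[of X] by (intro restrict_ext) simp
qed


section \<open>The closure systems of $z$-ideals and of $g$-closed ideals\<close>

context csemiring
begin

section \<open>The closure system of z-ideals\<close>

lemma z_ideal_carrier: "z_ideal S (carrier S)"
  by (simp add: z_ideal_def ideal_carrier)

lemma z_ideal_Inter:
  assumes "\<I> \<noteq> {}" "\<And>I. I \<in> \<I> \<Longrightarrow> z_ideal S I"
  shows "z_ideal S (\<Inter>\<I>)"
proof -
  have "semiring_ideal S (\<Inter>\<I>)"
    using assms by (intro ideal_Inter) (auto simp: z_ideal_def)
  moreover have "b \<in> I" if "a \<in> \<Inter>\<I>" "b \<in> carrier S" "max_ideals_at S a = max_ideals_at S b" "I \<in> \<I>"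
    for a b I
    using assms(2)[OF that(4)] that unfolding z_ideal_def by blast
  ultimately show ?thesis
    unfolding z_ideal_def by blast
qed

lemma ideal_closure_z: "ideal_closure S {I. z_ideal S I} (zcl S)"
proof unfold_locales
  show "\<Inter>\<I> \<in> {I. z_ideal S I}" if "\<I> \<subseteq> {I. z_ideal S I}" "\<I> \<noteq> {}" for \<I>
    using that by (auto intro!: z_ideal_Inter)
qed (simp_all add: z_ideal_carrier zcl_def, simp add: z_ideal_def)

text \<open>Serves the finitariness of \<open>zcl\<close>. Every defining condition except closure
  under addition concerns one element of the ideal at a time; directedness is what addition
  needs.\<close>

lemma z_ideal_directed_Union:
  assumes "\<I> \<noteq> {}" "\<And>I. I \<in> \<I> \<Longrightarrow> z_ideal S I"
    and dir: "\<And>I J. I \<in> \<I> \<Longrightarrow> J \<in> \<I> \<Longrightarrow> \<exists>K\<in>\<I>. I \<subseteq> K \<and> J \<subseteq> K"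
  shows "z_ideal S (\<Union>\<I>)"
proof -
  have I: "semiring_ideal S I" if "I \<in> \<I>" for I using assms(2)[OF that] by (simp add: z_ideal_def)
  have "a \<oplus> b \<in> \<Union>\<I>" if ab: "a \<in> \<Union>\<I>" "b \<in> \<Union>\<I>" for a b
  proof -
    obtain K where "K \<in> \<I>" "a \<in> K" "b \<in> K" using ab dir by blast
    then show ?thesis using ideal_add[OF I] by blast
  qed
  moreover have "\<Union>\<I> \<subseteq> carrier S" using I ideal_subset by blast
  moreover have "\<Union>\<I> \<noteq> {}" using assms(1) I ideal_zero by blast
  moreover have "s \<otimes> a \<in> \<Union>\<I>" if "a \<in> \<Union>\<I>" "s \<in> carrier S" for s a
    using that I ideal_mult_left by blast
  ultimately have "semiring_ideal S (\<Union>\<I>)"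
    unfolding semiring_ideal_def by blast
  moreover have "b \<in> \<Union>\<I>"
    if "a \<in> I" "I \<in> \<I>" "b \<in> carrier S" "max_ideals_at S a = max_ideals_at S b" for a b I
    using assms(2)[OF that(2)] that unfolding z_ideal_def by blast
  ultimately show ?thesis
    unfolding z_ideal_def by blast
qed

text \<open>
  Primeness of maximal ideals makes residuals of $z$-ideals $z$-ideals, which yields the law
  \<open>cl_mult\<close> for \<open>zcl\<close> without an explicit description of the closure.
\<close>

lemma z_ideal_residual:
  assumes K: "z_ideal S K" and B: "B \<subseteq> carrier S"
  shows "z_ideal S {x \<in> carrier S. \<forall>b\<in>B. x \<otimes> b \<in> K}"
proof -
  have I: "semiring_ideal S K" using K by (simp add: z_ideal_def)
  have "semiring_ideal S {x \<in> carrier S. \<forall>b\<in>B. x \<otimes> b \<in> K}"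
    unfolding semiring_ideal_def
  proof (intro conjI ballI)
    show "{x \<in> carrier S. \<forall>b\<in>B. x \<otimes> b \<in> K} \<noteq> {}"
      using B ideal_zero[OF I] by (auto intro!: exI[of _ \<zero>] simp: subset_iff)
    show "x \<oplus> y \<in> {x \<in> carrier S. \<forall>b\<in>B. x \<otimes> b \<in> K}"
      if "x \<in> {x \<in> carrier S. \<forall>b\<in>B. x \<otimes> b \<in> K}" "y \<in> {x \<in> carrier S. \<forall>b\<in>B. x \<otimes> b \<in> K}" for x y
      using that B by (auto simp: subset_iff l_distr ideal_add[OF I])
    show "s \<otimes> x \<in> {x \<in> carrier S. \<forall>b\<in>B. x \<otimes> b \<in> K}"
      if "s \<in> carrier S" "x \<in> {x \<in> carrier S. \<forall>b\<in>B. x \<otimes> b \<in> K}" for s x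
      using that B by (auto simp: subset_iff m_assoc ideal_mult_left[OF I])
  qed auto
  moreover have "y \<otimes> b \<in> K" if "x \<in> carrier S" "y \<in> carrier S" "x \<otimes> b \<in> K" "b \<in> B"
    "max_ideals_at S x = max_ideals_at S y" for x y b
  proof -
    have "b \<in> carrier S" using that B by auto
    then have "max_ideals_at S (x \<otimes> b) = max_ideals_at S (y \<otimes> b)"
      using that by (simp add: max_ideals_at_mult)
    then show ?thesis
      using K that \<open>b \<in> carrier S\<close> unfolding z_ideal_def by (meson m_closed)
  qed
  ultimately show ?thesis unfolding z_ideal_def by blast
qed

lemma finitary_mult_closure_z: "finitary_mult_closure S {I. z_ideal S I} (zcl S)"
proof -
  interpret z: ideal_closure S "{I. z_ideal S I}" "zcl S" by (rule ideal_closure_z)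
  show ?thesis
  proof unfold_locales
    fix A a assume A: "A \<subseteq> carrier S" and a: "a \<in> zcl S A"
    \<comment> \<open>The closures of finite subsets of A are directed, so their union is a z-ideal.
      It contains A and therefore the closure of A.\<close>
    let ?\<U> = "zcl S ` {F. finite F \<and> F \<subseteq> A}"
    have "z_ideal S (\<Union>?\<U>)"
    proof (rule z_ideal_directed_Union)
      show "?\<U> \<noteq> {}" by blast
      show "z_ideal S I" if "I \<in> ?\<U>" for I using that z.cl_closed A by auto
      fix I J assume "I \<in> ?\<U>" "J \<in> ?\<U>"
      then obtain F G where *: "finite F" "F \<subseteq> A" "I = zcl S F" "finite G" "G \<subseteq> A" "J = zcl S G"
        by auto
      then have FG: "F \<union> G \<subseteq> carrier S" "F \<union> G \<in> {F. finite F \<and> F \<subseteq> A}" using A by auto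
      have "I \<subseteq> zcl S (F \<union> G)" "J \<subseteq> zcl S (F \<union> G)"
        unfolding *(3,6) by (rule z.cl_mono[OF _ FG(1)], blast)+
      then show "\<exists>K\<in>?\<U>. I \<subseteq> K \<and> J \<subseteq> K" using FG(2) by blast
    qed
    moreover have "A \<subseteq> \<Union>?\<U>"
    proof
      fix x assume "x \<in> A"
      then have "x \<in> zcl S {x}" "{x} \<subseteq> A" using z.cl_extensive[of "{x}"] A by auto
      then show "x \<in> \<Union>?\<U>" by blast
    qed
    ultimately have "zcl S A \<subseteq> \<Union>?\<U>" using z.cl_subset_iff A by simp
    then show "\<exists>F. finite F \<and> F \<subseteq> A \<and> a \<in> zcl S F" using a by blast
  next
    fix A B assume A: "A \<subseteq> carrier S" and B: "B \<subseteq> carrier S"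
    let ?C = "{a \<otimes> b | a b. a \<in> A \<and> b \<in> B}" and ?K = "zcl S {a \<otimes> b | a b. a \<in> A \<and> b \<in> B}"
    have C: "?C \<subseteq> carrier S" using A B by auto
    note K = z.cl_closed[OF C, simplified]
    note clA = z.cl_in_carrier[OF A] and clB = z.cl_in_carrier[OF B]
    \<comment> \<open>First residual pass: the x that multiply B into \<open>?K\<close> form a
      z-ideal containing A, hence containing the closure of A.\<close>
    have 1: "x \<otimes> b \<in> ?K" if "x \<in> zcl S A" "b \<in> B" for x b
    proof -
      have "A \<subseteq> {x \<in> carrier S. \<forall>b\<in>B. x \<otimes> b \<in> ?K}"
        using A z.cl_extensive[OF C] by blast
      then have "zcl S A \<subseteq> {x \<in> carrier S. \<forall>b\<in>B. x \<otimes> b \<in> ?K}"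
        using z.cl_subset_iff[OF A, of "{x \<in> carrier S. \<forall>b\<in>B. x \<otimes> b \<in> ?K}"] z_ideal_residual[OF K B]
        by simp
      then show ?thesis using that by auto
    qed
    \<comment> \<open>Second pass: the multipliers are now the whole closure of A, and B is enlarged
      to its closure.\<close>
    have 2: "y \<otimes> x \<in> ?K" if "x \<in> zcl S A" "y \<in> zcl S B" for x y
    proof -
      have "B \<subseteq> {y \<in> carrier S. \<forall>x\<in>zcl S A. y \<otimes> x \<in> ?K}"
      proof clarify
        fix y assume "y \<in> B"
        then have "y \<in> carrier S" using B by auto
        moreover have "y \<otimes> x \<in> ?K" if "x \<in> zcl S A" for x
          using 1[OF that \<open>y \<in> B\<close>] m_comm[of x y] \<open>y \<in> carrier S\<close> clA that by auto
        ultimately show "y \<in> carrier S \<and> (\<forall>x\<in>zcl S A. y \<otimes> x \<in> ?K)" by blast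
      qed
      then have "zcl S B \<subseteq> {y \<in> carrier S. \<forall>x\<in>zcl S A. y \<otimes> x \<in> ?K}"
        using z.cl_subset_iff[OF B, of "{y \<in> carrier S. \<forall>x\<in>zcl S A. y \<otimes> x \<in> ?K}"]
          z_ideal_residual[OF K clA] by simp
      then show ?thesis using that by auto
    qed
    show "zcl S A \<inter> zcl S B = ?K"
    proof
      show "zcl S A \<inter> zcl S B \<subseteq> ?K"
      proof
        \<comment> \<open>Taking both factors equal to x puts the square of x in \<open>?K\<close>;
          x lies in the same maximal ideals as its square.\<close>
        fix x assume x: "x \<in> zcl S A \<inter> zcl S B"
        then have "x \<in> carrier S" "x \<otimes> x \<in> ?K" using 2 clA by auto
        moreover from this have "max_ideals_at S (x \<otimes> x) = max_ideals_at S x"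
          by (simp add: max_ideals_at_mult)
        ultimately show "x \<in> ?K" using K unfolding z_ideal_def by meson
      qed
      have "?C \<subseteq> zcl S A \<inter> zcl S B"
      proof clarify
        fix a b assume ab: "a \<in> A" "b \<in> B"
        then have "a \<in> carrier S" "b \<in> carrier S" "a \<in> zcl S A" "b \<in> zcl S B"
          using A B z.cl_extensive by blast+
        then show "a \<otimes> b \<in> zcl S A \<inter> zcl S B"
          using ideal_mult_right[OF z.closed_ideal[OF z.cl_closed[OF A]]]
            ideal_mult_left[OF z.closed_ideal[OF z.cl_closed[OF B]]] by blast
      qed
      moreover have "zcl S A \<inter> zcl S B \<in> {I. z_ideal S I}"
        using A B by (intro z.Int_closed z.cl_closed)
      ultimately show "?K \<subseteq> zcl S A \<inter> zcl S B"
        using z.cl_subset_iff[OF C] by blast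
    qed
  qed
qed

section \<open>The closure system of g-closed ideals\<close>

lemma ideal_closure_g: "ideal_closure S {I. g_closed S I} (gcl S)"
proof unfold_locales
  show "semiring_ideal S I" if "I \<in> {I. g_closed S I}" for I
    using that by (simp add: g_closed_def)
  show "carrier S \<in> {I. g_closed S I}"
    using gcl_extensive[of "carrier S"] ideal_subset[OF gcl_ideal]
    by (auto simp: g_closed_def ideal_carrier)
  show "\<Inter>\<I> \<in> {I. g_closed S I}" if "\<I> \<subseteq> {I. g_closed S I}" "\<I> \<noteq> {}" for \<I>
  proof -
    have "\<Inter>\<I> \<subseteq> carrier S" using that ideal_subset by (auto simp: g_closed_def)
    moreover have "gcl S (\<Inter>\<I>) \<subseteq> I" if "I \<in> \<I>" for I
      using gcl_mono[of "\<Inter>\<I>" I] that \<open>\<I> \<subseteq> _\<close> by (auto simp: g_closed_def)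
    ultimately have "gcl S (\<Inter>\<I>) = \<Inter>\<I>"
      using gcl_extensive by blast
    then show ?thesis using gcl_ideal[of "\<Inter>\<I>"] by (simp add: g_closed_def)
  qed
  show "gcl S A = \<Inter>{J \<in> {I. g_closed S I}. A \<subseteq> J}" if A: "A \<subseteq> carrier S" for A
  proof
    show "gcl S A \<subseteq> \<Inter>{J \<in> {I. g_closed S I}. A \<subseteq> J}"
    proof clarify
      fix x J assume "x \<in> gcl S A" "g_closed S J" "A \<subseteq> J"
      then show "x \<in> J" using gcl_mono[of A J] by (auto simp: g_closed_def)
    qed
    show "\<Inter>{J \<in> {I. g_closed S I}. A \<subseteq> J} \<subseteq> gcl S A"
      using gcl_closed[OF A] gcl_extensive[OF A] by auto
  qed
qed

lemma gprinc_eq: "gprinc S a = gcl S {a}"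
  unfolding gprinc_def by (intro gcl_cong_ideal ideal_gen_subset_iff)

lemma zprinc_eq: "zprinc S a = zcl S {a}"
  unfolding zprinc_def by (intro zcl_cong_ideal ideal_gen_subset_iff)

text \<open>Evaluates the joins in \<open>G3\<close> and \<open>Idg_map\<close>: the sum becomes a
  union, and the inner closures then drop out.\<close>

lemma gjoin_gprinc:
  assumes "A \<subseteq> carrier S" shows "gjoin S (gprinc S ` A) = gcl S A"
proof -
  interpret g: ideal_closure S "{I. g_closed S I}" "gcl S" by (rule ideal_closure_g)
  have "gjoin S (gprinc S ` A) = gcl S (\<Union>(gprinc S ` A))"
    unfolding gjoin_def using assms
    by (intro gcl_cong_ideal ideal_sum_subset_iff) (auto simp: gprinc_eq dest: g.cl_in_carrier[THEN subsetD, rotated])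
  then show ?thesis
    using assms by (simp add: gprinc_eq g.cl_UN_singletons)
qed

lemma zjoin_zprinc:
  assumes "A \<subseteq> carrier S" shows "zjoin S (zprinc S ` A) = zcl S A"
proof -
  interpret z: ideal_closure S "{I. z_ideal S I}" "zcl S" by (rule ideal_closure_z)
  have "zjoin S (zprinc S ` A) = zcl S (\<Union>(zprinc S ` A))"
    unfolding zjoin_def using assms
    by (intro zcl_cong_ideal ideal_sum_subset_iff) (auto simp: zprinc_eq dest: z.cl_in_carrier[THEN subsetD, rotated])
  then show ?thesis
    using assms by (simp add: zprinc_eq z.cl_UN_singletons)
qed

lemma finitary_mult_closure_g:
  assumes G: "finite_type_g_closure S"
  shows "finitary_mult_closure S {I. g_closed S I} (gcl S)"
proof -
  interpret g: ideal_closure S "{I. g_closed S I}" "gcl S" by (rule ideal_closure_g)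
  have L: "Idg S = g.L" by (simp add: Idg_def)
  have princ_closed: "(\<lambda>a. gcl S {a}) ` A \<subseteq> {I. g_closed S I}" if "A \<subseteq> carrier S" for A
    using that by (auto intro!: gcl_closed)
  have sup: "\<Squnion>\<^bsub>g.L\<^esub> ((\<lambda>a. gcl S {a}) ` A) = gcl S A" if "A \<subseteq> carrier S" for A
    unfolding g.sup_eq[OF princ_closed[OF that]] by (rule g.cl_UN_singletons[OF that])
  have "is_frame g.L"
    using G by (simp only: finite_type_g_closure_def G2_def L)
  then have distrib: "\<forall>I\<in>carrier g.L. \<forall>\<I>. \<I> \<subseteq> carrier g.L \<longrightarrow>
      I \<sqinter>\<^bsub>g.L\<^esub> \<Squnion>\<^bsub>g.L\<^esub> \<I> = \<Squnion>\<^bsub>g.L\<^esub> ((\<lambda>J. I \<sqinter>\<^bsub>g.L\<^esub> J) ` \<I>)"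
    unfolding is_frame_def by (rule conjunct2)
  \<comment> \<open>The distributive law of (G2), translated from lattice operations to
    intersections and \<open>gcl\<close>.\<close>
  have frame: "I \<inter> gcl S (\<Union>\<I>) = gcl S (\<Union>J\<in>\<I>. I \<inter> J)"
    if "g_closed S I" "\<I> \<subseteq> {I. g_closed S I}" for I \<I>
  proof -
    have "I \<sqinter>\<^bsub>g.L\<^esub> \<Squnion>\<^bsub>g.L\<^esub> \<I> = \<Squnion>\<^bsub>g.L\<^esub> ((\<lambda>J. I \<sqinter>\<^bsub>g.L\<^esub> J) ` \<I>)"
      using that by (intro distrib[rule_format]) simp_all
    moreover have "(\<lambda>J. I \<sqinter>\<^bsub>g.L\<^esub> J) ` \<I> = (\<lambda>J. I \<inter> J) ` \<I>"
      using that by (intro image_cong) (auto intro!: g.meet_eq)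
    moreover have "(\<lambda>J. I \<inter> J) ` \<I> \<subseteq> {I. g_closed S I}"
      using that g.Int_closed by auto
    ultimately show ?thesis
      using that g.sup_eq[of \<I>] g.sup_eq[of "(\<lambda>J. I \<inter> J) ` \<I>"]
        g.meet_eq[of I "gcl S (\<Union>\<I>)"] g.cl_closed[OF g.Union_in_carrier, of \<I>]
      by (metis mem_Collect_eq)
  qed
  show ?thesis
  proof unfold_locales
    fix A a assume A: "A \<subseteq> carrier S" and a: "a \<in> gcl S A"
    then have aS: "a \<in> carrier S" using g.cl_in_carrier by blast
    \<comment> \<open>A singleton is a finite index set, so (G3) makes this principal closure
      compact.\<close>
    have "gcl S {a} = gjoin S (gprinc S ` {a})"
      using aS by (subst gjoin_gprinc) auto
    then have "gcl S {a} \<in> {gjoin S (gprinc S ` B) | B. finite B \<and> B \<subseteq> carrier S}"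
      using aS by blast
    then have "gcl S {a} \<in> compacts g.L"
      using G by (simp add: finite_type_g_closure_def G3_def L)
    \<comment> \<open>It lies below the join of the principal closures of A, so finitely many of
      them suffice.\<close>
    moreover have "gcl S {a} \<subseteq> \<Squnion>\<^bsub>g.L\<^esub> ((\<lambda>a. gcl S {a}) ` A)"
      using A a aS by (simp add: sup g.cl_subset_cl_iff)
    ultimately obtain \<F> where \<F>: "finite \<F>" "\<F> \<subseteq> (\<lambda>a. gcl S {a}) ` A" "gcl S {a} \<subseteq> \<Squnion>\<^bsub>g.L\<^esub> \<F>"
      using princ_closed[OF A] unfolding compacts_def g.order_simps by blast
    then obtain F where F: "finite F" "F \<subseteq> A" "\<F> = (\<lambda>a. gcl S {a}) ` F"
      by (auto dest: finite_subset_image)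
    then have "gcl S {a} \<subseteq> gcl S F" using \<F> A sup by auto
    then show "\<exists>F. finite F \<and> F \<subseteq> A \<and> a \<in> gcl S F"
      using F gcl_extensive[of "{a}"] aS by blast
  next
    fix A B assume A: "A \<subseteq> carrier S" and B: "B \<subseteq> carrier S"
    \<comment> \<open>One factor a singleton: distribute over the principal closures of B, then
      apply (G4) to each pair.\<close>
    have 1: "gcl S {a} \<inter> gcl S B = gcl S {a \<otimes> b | b. b \<in> B}" if "a \<in> carrier S" for a
    proof -
      have "gcl S {a} \<inter> gcl S B = gcl S {a} \<inter> gcl S (\<Union>((\<lambda>b. gcl S {b}) ` B))"
        using B by (simp add: g.cl_UN_singletons)
      also have "\<dots> = gcl S (\<Union>b\<in>B. gcl S {a} \<inter> gcl S {b})"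
        using B that by (subst frame) (auto intro!: gcl_closed)
      also have "\<dots> = gcl S (\<Union>b\<in>B. gcl S {a \<otimes> b})"
        using G that B by (intro arg_cong[of _ _ "gcl S"] SUP_cong)
          (auto simp: finite_type_g_closure_def G4_def gprinc_eq)
      also have "\<dots> = gcl S {a \<otimes> b | b. b \<in> B}"
        using that B g.cl_UN_singletons[of "(\<lambda>b. a \<otimes> b) ` B"]
        by (auto simp: image_subset_iff Setcompr_eq_image)
      finally show ?thesis .
    qed
    \<comment> \<open>Now A is resolved into principal closures, and the previous case applies to
      each of its elements.\<close>
    have "gcl S A \<inter> gcl S B = gcl S B \<inter> gcl S (\<Union>((\<lambda>a. gcl S {a}) ` A))"
      using A by (simp add: g.cl_UN_singletons Int_commute)
    also have "\<dots> = gcl S (\<Union>a\<in>A. gcl S {a} \<inter> gcl S B)"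
      using A B by (subst frame) (auto intro!: gcl_closed simp: Int_commute)
    also have "\<dots> = gcl S (\<Union>a\<in>A. gcl S {a \<otimes> b | b. b \<in> B})"
      by (intro arg_cong[of _ _ "gcl S"] SUP_cong refl 1 subsetD[OF A])
    also have "\<dots> = gcl S (\<Union>((\<lambda>a. {a \<otimes> b | b. b \<in> B}) ` A))"
      using g.cl_Union_cl[of "(\<lambda>a. {a \<otimes> b | b. b \<in> B}) ` A"] A B by (auto simp: image_image)
    also have "(\<Union>((\<lambda>a. {a \<otimes> b | b. b \<in> B}) ` A)) = {a \<otimes> b | a b. a \<in> A \<and> b \<in> B}" by auto
    finally show "gcl S A \<inter> gcl S B = gcl S {a \<otimes> b | a b. a \<in> A \<and> b \<in> B}" .
  qed
qed

end


section \<open>The categories and functors\<close>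

lemma coherent_frame_hom_compose:
  assumes L: "complete_lattice L" and f: "f \<in> coherent_frame_hom L M"
    and g: "g \<in> coherent_frame_hom M N"
  shows "compose (carrier L) g f \<in> coherent_frame_hom L N"
proof -
  \<comment> \<open>Completeness keeps tops, meets and joins inside \<open>carrier L\<close>, where
    the composite is computed pointwise.\<close>
  interpret complete_lattice L by fact
  let ?h = "compose (carrier L) g f"
  have fL: "f \<in> carrier L \<rightarrow>\<^sub>E carrier M" "f \<top>\<^bsub>L\<^esub> = \<top>\<^bsub>M\<^esub>"
      "\<And>x y. x \<in> carrier L \<Longrightarrow> y \<in> carrier L \<Longrightarrow> f (x \<sqinter>\<^bsub>L\<^esub> y) = f x \<sqinter>\<^bsub>M\<^esub> f y"
      "\<And>A. A \<subseteq> carrier L \<Longrightarrow> f (\<Squnion>\<^bsub>L\<^esub> A) = \<Squnion>\<^bsub>M\<^esub> (f ` A)" "f ` compacts L \<subseteq> compacts M"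
    using f by (simp_all add: coherent_frame_hom_def frame_hom_def)
  have gM: "g \<in> carrier M \<rightarrow>\<^sub>E carrier N" "g \<top>\<^bsub>M\<^esub> = \<top>\<^bsub>N\<^esub>"
      "\<And>x y. x \<in> carrier M \<Longrightarrow> y \<in> carrier M \<Longrightarrow> g (x \<sqinter>\<^bsub>M\<^esub> y) = g x \<sqinter>\<^bsub>N\<^esub> g y"
      "\<And>A. A \<subseteq> carrier M \<Longrightarrow> g (\<Squnion>\<^bsub>M\<^esub> A) = \<Squnion>\<^bsub>N\<^esub> (g ` A)" "g ` compacts M \<subseteq> compacts N"
    using g by (simp_all add: coherent_frame_hom_def frame_hom_def)
  have f_closed: "f x \<in> carrier M" if "x \<in> carrier L" for x using fL(1) that by auto
  have h: "?h x = g (f x)" if "x \<in> carrier L" for x using that by (simp add: compose_def)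
  have "?h \<in> frame_hom L N"
    unfolding frame_hom_def
  proof (intro CollectI conjI ballI allI impI)
    show "?h \<in> carrier L \<rightarrow>\<^sub>E carrier N"
      using fL(1) gM(1) by (auto simp: compose_def)
    show "?h \<top>\<^bsub>L\<^esub> = \<top>\<^bsub>N\<^esub>" by (simp add: h fL gM)
    show "?h (x \<sqinter>\<^bsub>L\<^esub> y) = ?h x \<sqinter>\<^bsub>N\<^esub> ?h y" if "x \<in> carrier L" "y \<in> carrier L" for x y
      using that by (simp add: h fL(3) gM(3) f_closed)
    show "?h (\<Squnion>\<^bsub>L\<^esub> A) = \<Squnion>\<^bsub>N\<^esub> (?h ` A)" if A: "A \<subseteq> carrier L" for A
    proof -
      have "?h ` A = g ` f ` A"
        unfolding image_image using A h by (intro image_cong) auto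
      moreover have "f ` A \<subseteq> carrier M" using A f_closed by blast
      ultimately show ?thesis using A by (simp add: h fL(4) gM(4))
    qed
  qed
  moreover have "?h x \<in> compacts N" if "x \<in> compacts L" for x
  proof -
    have "x \<in> carrier L" using that by (simp add: compacts_def)
    then show ?thesis using that fL(5) gM(5) by (simp add: h) blast
  qed
  ultimately show ?thesis unfolding coherent_frame_hom_def by blast
qed

lemma coherent_frame_hom_id:
  assumes "complete_lattice L" shows "(\<lambda>x\<in>carrier L. x) \<in> coherent_frame_hom L L"
proof -
  interpret complete_lattice L by fact
  have "(\<lambda>x\<in>carrier L. x) ` A = A" if "A \<subseteq> carrier L" for A using that by force
  moreover have "compacts L \<subseteq> carrier L" by (auto simp: compacts_def)
  ultimately show ?thesis
    by (simp add: coherent_frame_hom_def frame_hom_def)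
qed

text \<open>Extensionality of arrows turns the identity laws into equations of functions.\<close>

lemma category_CohFrm: "is_category CohFrm"
proof -
  have lat: "complete_lattice L" if "coherent_frame L" for L :: "'b gorder"
    using that by (simp add: coherent_frame_def is_frame_def)
  have hom: "f \<in> extensional (carrier L)" "f \<in> carrier L \<rightarrow> carrier M"
    if "f \<in> coherent_frame_hom L M" for f and L M :: "'b gorder"
    using that by (auto simp: coherent_frame_hom_def frame_hom_def PiE_iff)
  show ?thesis
    unfolding is_category_def CohFrm_def cat.simps mem_Collect_eq
  proof (intro conjI ballI coherent_frame_hom_id coherent_frame_hom_compose lat)
    show "compose (carrier L) f (\<lambda>x\<in>carrier L. x) = f" "compose (carrier L) (\<lambda>x\<in>carrier M. x) f = f"
      if "f \<in> coherent_frame_hom L M" for f and L M :: "'b gorder"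
      using hom[OF that] by (auto simp: compose_def fun_eq_iff extensional_def)
    show "compose (carrier K) h (compose (carrier K) g f)
        = compose (carrier K) (compose (carrier L) h g) f"
      if "f \<in> coherent_frame_hom K L" for f g h and K L :: "'b gorder"
      using hom[OF that] by (auto simp: compose_def fun_eq_iff)
  qed simp_all
qed

text \<open>One proof for both functors. The arrow part is prescribed only on arrows, because
  rewriting a join of principal closures as an extension uses that \<phi> maps into the carrier of
  the target.\<close>

lemma functor_extension:
  fixes X :: "'a ring \<Rightarrow> 'a set set"
  assumes C: "is_category C" "Idm C = (\<lambda>S. \<lambda>a\<in>carrier S. a)"
      "Cmp C = (\<lambda>S T U \<psi> \<phi>. compose (carrier S) \<psi> \<phi>)"
    and obj: "\<And>S. S \<in> Obj C \<Longrightarrow> finitary_mult_closure S (X S) (cl S)"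
    and hom: "\<And>S T \<phi>. S \<in> Obj C \<Longrightarrow> T \<in> Obj C \<Longrightarrow> \<phi> \<in> Hom C S T \<Longrightarrow>
      closure_hom S (X S) (cl S) T (X T) (cl T) \<phi>"
    and F: "\<And>S. omap F S = inclusion_order (X S)"
      "\<And>S T \<phi>. S \<in> Obj C \<Longrightarrow> T \<in> Obj C \<Longrightarrow> \<phi> \<in> Hom C S T \<Longrightarrow> amap F S T \<phi> = extension (X S) (cl T) \<phi>"
  shows "is_functor C CohFrm F"
  unfolding is_functor_def
proof (intro conjI ballI C(1) category_CohFrm)
  have car: "carrier (inclusion_order (X S)) = X S" for S by (simp add: inclusion_order_def)
  show "omap F S \<in> Obj CohFrm" if "S \<in> Obj C" for S
    using finitary_mult_closure.coherent_frame_L[OF obj[OF that]] by (simp add: F CohFrm_def)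
  show "amap F S T \<phi> \<in> Hom CohFrm (omap F S) (omap F T)"
    if "S \<in> Obj C" "T \<in> Obj C" "\<phi> \<in> Hom C S T" for S T \<phi>
    using closure_hom.extension_coherent[OF hom[OF that]] that by (simp add: F CohFrm_def)
  show "amap F S S (Idm C S) = Idm CohFrm (omap F S)" if "S \<in> Obj C" for S
  proof -
    \<comment> \<open>The arrow part is known only on arrows, so the identity must first be
      recognised as one.\<close>
    have "Idm C S \<in> Hom C S S" using C(1) that by (simp add: is_category_def)
    then show ?thesis
      using that finitary_mult_closure.extension_id[OF obj[OF that]]
      by (simp add: F CohFrm_def C car)
  qed
  show "amap F S U (Cmp C S T U \<psi> \<phi>)
      = Cmp CohFrm (omap F S) (omap F T) (omap F U) (amap F T U \<psi>) (amap F S T \<phi>)"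
    if "S \<in> Obj C" "T \<in> Obj C" "U \<in> Obj C" "\<phi> \<in> Hom C S T" "\<psi> \<in> Hom C T U" for S T U \<phi> \<psi>
  proof -
    have "Cmp C S T U \<psi> \<phi> \<in> Hom C S U" using C(1) that unfolding is_category_def by blast
    then show ?thesis
      using that extension_compose[OF hom[of S T \<phi>] hom[of T U \<psi>]]
      by (simp add: F CohFrm_def C car)
  qed
qed

section \<open>The category \<open>CRig_g_sigma\<close> and its two functors\<close>

lemma CRig_g_sigma_objD:
  assumes "S \<in> Obj CRig_g_sigma"
  shows "csemiring S" "finitary_mult_closure S {I. z_ideal S I} (zcl S)"
    "finitary_mult_closure S {I. g_closed S I} (gcl S)"
    "sigma S \<in> coherent_frame_hom (ZId S) (Idg S)"
  using assms csemiring.finitary_mult_closure_z csemiring.finitary_mult_closure_g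
  by (auto simp: CRig_g_sigma_def CRig_g_def csemiring_iff)

lemma CRig_g_sigma_homD:
  assumes "S \<in> Obj CRig_g_sigma" "T \<in> Obj CRig_g_sigma" "\<phi> \<in> Hom CRig_g_sigma S T"
  shows "closure_hom S {I. z_ideal S I} (zcl S) T {I. z_ideal T I} (zcl T) \<phi>"
    "closure_hom S {I. g_closed S I} (gcl S) T {I. g_closed T I} (gcl T) \<phi>"
  using CRig_g_sigma_objD[OF assms(1)] CRig_g_sigma_objD[OF assms(2)] assms(3)
  by (auto simp: closure_hom_def closure_hom_axioms_def CRig_g_sigma_def CRig_g_def CRig_g_hom_def)

lemma Idg_map_eq:
  assumes "csemiring S" "csemiring T" "\<phi> \<in> semiring_hom S T"
  shows "Idg_map S T \<phi> = extension {I. g_closed S I} (gcl T) \<phi>"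
proof -
  interpret S: csemiring S by fact
  interpret T: csemiring T by fact
  have "gjoin T ((\<lambda>a. gprinc T (\<phi> a)) ` I) = gcl T (\<phi> ` I)" if "g_closed S I" for I
  proof -
    have "\<phi> ` I \<subseteq> carrier T"
      using that assms(3) S.ideal_subset by (auto simp: g_closed_def semiring_hom_def ring_hom_closed subset_iff)
    then show ?thesis using T.gjoin_gprinc[of "\<phi> ` I"] by (simp add: image_image)
  qed
  then show ?thesis
    by (auto simp: Idg_map_def extension_def Idg_def inclusion_order_def intro!: restrict_ext)
qed

lemma ZId_map_eq:
  assumes "csemiring S" "csemiring T" "\<phi> \<in> semiring_hom S T"
  shows "ZId_map S T \<phi> = extension {I. z_ideal S I} (zcl T) \<phi>"
proof -
  interpret S: csemiring S by fact
  interpret T: csemiring T by fact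
  have "zjoin T ((\<lambda>a. zprinc T (\<phi> a)) ` I) = zcl T (\<phi> ` I)" if "z_ideal S I" for I
  proof -
    have "\<phi> ` I \<subseteq> carrier T"
      using that assms(3) S.ideal_subset by (auto simp: z_ideal_def semiring_hom_def ring_hom_closed subset_iff)
    then show ?thesis using T.zjoin_zprinc[of "\<phi> ` I"] by (simp add: image_image)
  qed
  then show ?thesis
    by (auto simp: ZId_map_def extension_def ZId_def inclusion_order_def intro!: restrict_ext)
qed

lemma CRig_g_sigma_maps:
  assumes "S \<in> Obj CRig_g_sigma" "T \<in> Obj CRig_g_sigma" "\<phi> \<in> Hom CRig_g_sigma S T"
  shows "ZId_map S T \<phi> = extension {I. z_ideal S I} (zcl T) \<phi>"
    "Idg_map S T \<phi> = extension {I. g_closed S I} (gcl T) \<phi>"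
  using CRig_g_sigma_objD(1)[OF assms(1)] CRig_g_sigma_objD(1)[OF assms(2)] assms(3)
  by (auto simp: CRig_g_sigma_def CRig_g_def CRig_g_hom_def intro!: ZId_map_eq Idg_map_eq)

lemma semiring_hom_id: "(\<lambda>a\<in>carrier S. a) \<in> semiring_hom S S" if "csemiring S"
proof -
  interpret csemiring S by fact
  show ?thesis by (auto simp: semiring_hom_def ring_hom_def)
qed

lemma semiring_hom_compose:
  assumes "csemiring S" "\<phi> \<in> semiring_hom S T" "\<psi> \<in> semiring_hom T U"
  shows "compose (carrier S) \<psi> \<phi> \<in> semiring_hom S U"
proof -
  interpret csemiring S by fact
  show ?thesis using assms(2,3)
    by (auto simp: semiring_hom_def ring_hom_def compose_def Pi_iff)
qed

text \<open>The delicate point is that the arrow condition survives composition. The map induced by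
  \<phi> sends the g-closure of \<open>zprinc S a\<close> to that of the z-closure of \<phi> a, and
  the condition for \<psi> then applies at \<phi> a.\<close>

lemma category_CRig_g_sigma: "is_category (CRig_g_sigma :: ('a ring, 'a \<Rightarrow> 'a) cat)"
proof -
  let ?C = "CRig_g_sigma :: ('a ring, 'a \<Rightarrow> 'a) cat"
  have Idm: "Idm ?C = (\<lambda>S. \<lambda>a\<in>carrier S. a)"
    and Cmp: "Cmp ?C = (\<lambda>S T U \<psi> \<phi>. compose (carrier S) \<psi> \<phi>)"
    by (simp_all add: CRig_g_sigma_def CRig_g_def)
  have Hom: "\<phi> \<in> Hom ?C S T \<longleftrightarrow> \<phi> \<in> semiring_hom S T \<and>
     (\<forall>J. z_ideal T J \<longrightarrow> z_ideal S {a \<in> carrier S. \<phi> a \<in> J}) \<and>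
     (\<forall>J. g_closed T J \<longrightarrow> g_closed S {a \<in> carrier S. \<phi> a \<in> J}) \<and>
     (\<forall>a\<in>carrier S. Idg_map S T \<phi> (gcl S (zprinc S a)) = gcl T (zprinc T (\<phi> a)))" for S T \<phi>
    by (auto simp: CRig_g_sigma_def CRig_g_def CRig_g_hom_def)
  have zprinc: "zprinc S a \<subseteq> carrier S" if "S \<in> Obj ?C" "a \<in> carrier S" for S a
  proof -
    interpret finitary_mult_closure S "{I. z_ideal S I}" "zcl S"
      using that(1) by (rule CRig_g_sigma_objD)
    show ?thesis using that cl_in_carrier[of "{a}"] by (simp add: zprinc_eq)
  qed
  \<comment> \<open>\<open>Idg_map\<close> is specified only on g-closed ideals, so its arguments
    must be known to be g-closed.\<close>
  have gz: "g_closed S (gcl S (zprinc S a))" if "S \<in> Obj ?C" "a \<in> carrier S" for S a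
    using csemiring.gcl_closed[OF CRig_g_sigma_objD(1)[OF that(1)] zprinc[OF that]] .
  have id: "(\<lambda>a\<in>carrier S. a) \<in> Hom ?C S S" if S: "S \<in> Obj ?C" for S
  proof -
    interpret g: finitary_mult_closure S "{I. g_closed S I}" "gcl S"
      using S by (rule CRig_g_sigma_objD)
    have sub: "{a \<in> carrier S. (\<lambda>a\<in>carrier S. a) a \<in> J} = J" if "semiring_ideal S J" for J
      using g.ideal_subset[OF that] by auto
    have hom: "(\<lambda>a\<in>carrier S. a) \<in> semiring_hom S S"
      by (rule semiring_hom_id) unfold_locales
    have "Idg_map S S (\<lambda>a\<in>carrier S. a) = (\<lambda>I\<in>{I. g_closed S I}. I)"
      using CRig_g_sigma_objD(1)[OF S] hom by (subst Idg_map_eq) (simp_all add: g.extension_id)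
    then have "Idg_map S S (\<lambda>a\<in>carrier S. a) (gcl S (zprinc S a))
        = gcl S (zprinc S ((\<lambda>a\<in>carrier S. a) a))" if "a \<in> carrier S" for a
      using gz[OF S that] that by simp
    moreover have "z_ideal S {a \<in> carrier S. (\<lambda>a\<in>carrier S. a) a \<in> J}" if "z_ideal S J" for J
      using that z_ideal_def[of S J] by (subst sub) simp_all
    moreover have "g_closed S {a \<in> carrier S. (\<lambda>a\<in>carrier S. a) a \<in> J}" if "g_closed S J" for J
      using that g_closed_def[of S J] by (subst sub) simp_all
    ultimately show ?thesis unfolding Hom using hom by blast
  qed
  have comp: "compose (carrier S) \<psi> \<phi> \<in> Hom ?C S U"
    if obj: "S \<in> Obj ?C" "T \<in> Obj ?C" "U \<in> Obj ?C" and \<phi>: "\<phi> \<in> Hom ?C S T" and \<psi>: "\<psi> \<in> Hom ?C T U"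
    for S T U \<phi> \<psi>
  proof -
    have hom: "compose (carrier S) \<psi> \<phi> \<in> semiring_hom S U"
      using \<phi> \<psi> CRig_g_sigma_objD(1)[OF obj(1)] unfolding Hom by (intro semiring_hom_compose) auto
    have \<phi>_closed: "\<phi> a \<in> carrier T" if "a \<in> carrier S" for a
      using \<phi> that unfolding Hom by (auto simp: semiring_hom_def ring_hom_closed)
    have pre: "{a \<in> carrier S. compose (carrier S) \<psi> \<phi> a \<in> J}
        = {a \<in> carrier S. \<phi> a \<in> {b \<in> carrier T. \<psi> b \<in> J}}" for J
      using \<phi>_closed by (auto simp: compose_def)
    \<comment> \<open>Functoriality is taken directly from \<open>extension_compose\<close>, since
      \<open>functor_Idg\<close> presupposes the category being established here.\<close>
    have "Idg_map S U (compose (carrier S) \<psi> \<phi>)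
        = compose {I. g_closed S I} (Idg_map T U \<psi>) (Idg_map S T \<phi>)"
      using obj \<phi> \<psi> hom
      by (simp add: CRig_g_sigma_maps extension_compose[OF CRig_g_sigma_homD(2) CRig_g_sigma_homD(2)]
          Idg_map_eq CRig_g_sigma_objD(1))
    then have "Idg_map S U (compose (carrier S) \<psi> \<phi>) (gcl S (zprinc S a))
        = gcl U (zprinc U (compose (carrier S) \<psi> \<phi> a))" if "a \<in> carrier S" for a
      using \<phi> \<psi> that gz[OF obj(1) that] \<phi>_closed unfolding Hom by (simp add: compose_def)
    moreover have "z_ideal S {a \<in> carrier S. compose (carrier S) \<psi> \<phi> a \<in> J}" if "z_ideal U J" for J
      unfolding pre using \<phi> \<psi> that unfolding Hom by blast
    moreover have "g_closed S {a \<in> carrier S. compose (carrier S) \<psi> \<phi> a \<in> J}" if "g_closed U J" for J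
      unfolding pre using \<phi> \<psi> that unfolding Hom by blast
    ultimately show ?thesis unfolding Hom using hom by blast
  qed
  have ext: "\<phi> \<in> extensional (carrier S)" "\<phi> \<in> carrier S \<rightarrow> carrier T" if "\<phi> \<in> Hom ?C S T" for \<phi> S T
    using that unfolding Hom by (auto simp: semiring_hom_def ring_hom_closed)
  show ?thesis
    unfolding is_category_def Idm Cmp
  proof (intro conjI ballI id comp)
    show "compose (carrier S) \<phi> (\<lambda>a\<in>carrier S. a) = \<phi>" "compose (carrier S) (\<lambda>a\<in>carrier T. a) \<phi> = \<phi>"
      if "\<phi> \<in> Hom ?C S T" for S T \<phi>
      using ext[OF that] by (auto simp: compose_def fun_eq_iff extensional_def)
    show "compose (carrier W) \<chi> (compose (carrier W) \<psi> \<phi>)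
        = compose (carrier W) (compose (carrier S) \<chi> \<psi>) \<phi>"
      if "\<phi> \<in> Hom ?C W S" for W S \<phi> \<psi> \<chi>
      using ext[OF that] by (auto simp: compose_def fun_eq_iff)
  qed
qed

lemma functor_ZId: "is_functor CRig_g_sigma CohFrm ZId_functor"
  by (rule functor_extension[where X = "\<lambda>S. {I. z_ideal S I}" and cl = zcl])
    (auto simp: category_CRig_g_sigma ZId_functor_def ZId_def CRig_g_sigma_objD CRig_g_sigma_homD
      CRig_g_sigma_maps, auto simp: CRig_g_sigma_def CRig_g_def)

lemma functor_Idg: "is_functor CRig_g_sigma CohFrm Idg_functor"
  by (rule functor_extension[where X = "\<lambda>S. {I. g_closed S I}" and cl = gcl])
    (auto simp: category_CRig_g_sigma Idg_functor_def Idg_def CRig_g_sigma_objD CRig_g_sigma_homD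
      CRig_g_sigma_maps, auto simp: CRig_g_sigma_def CRig_g_def)

section \<open>Naturality of \<open>sigma\<close>\<close>

lemma sigma_natural:
  assumes S: "S \<in> Obj CRig_g_sigma" and T: "T \<in> Obj CRig_g_sigma"
    and \<phi>: "\<phi> \<in> Hom CRig_g_sigma S T" and I: "z_ideal S I"
  shows "sigma T (ZId_map S T \<phi> I) = Idg_map S T \<phi> (sigma S I)"
proof -
  interpret z: closure_hom S "{I. z_ideal S I}" "zcl S" T "{I. z_ideal T I}" "zcl T" \<phi>
    using assms by (intro CRig_g_sigma_homD)
  interpret g: closure_hom S "{I. g_closed S I}" "gcl S" T "{I. g_closed T I}" "gcl T" \<phi>
    using assms by (intro CRig_g_sigma_homD)
  note maps = CRig_g_sigma_maps[OF S T \<phi>]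
  \<comment> \<open>Preservation of joins is part of the condition imposed on objects.\<close>
  have \<sigma>_sup: "sigma R (\<Squnion>\<^bsub>ZId R\<^esub> \<I>) = \<Squnion>\<^bsub>Idg R\<^esub> (sigma R ` \<I>)"
    if "R \<in> Obj CRig_g_sigma" "\<I> \<subseteq> {I. z_ideal R I}" for R :: "'a ring" and \<I>
    using CRig_g_sigma_objD(4)[OF that(1)] that(2)
    by (simp add: coherent_frame_hom_def frame_hom_def ZId_def inclusion_order_def)
  have \<sigma>_eq: "sigma R J = gcl R J" if "z_ideal R J" for R :: "'a ring" and J
    using that by (simp add: sigma_def ZId_def inclusion_order_def)
  have IS: "I \<subseteq> carrier S" using I z.S.closed_subset by simp
  note \<phi>I = z.image_in_carrier[OF IS]
  have zS: "z_ideal S (zprinc S a)" "z_ideal T (zprinc T (\<phi> a))" if "a \<in> I" for a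
    using that IS \<phi>I z.S.cl_closed[of "{a}"] z.T.cl_closed[of "{\<phi> a}"]
    by (auto simp: z.S.zprinc_eq z.T.zprinc_eq)
  have gS: "g_closed S (gcl S (zprinc S a))" if "a \<in> I" for a
    using zS[OF that] z.S.closed_subset by (intro z.S.gcl_closed) simp
  have "I = \<Squnion>\<^bsub>ZId S\<^esub> (zprinc S ` I)"
    using I IS zS(1) unfolding ZId_def
    by (subst z.S.sup_eq) (auto simp: z.S.zprinc_eq z.S.cl_UN_singletons z.S.cl_id)
  then have "sigma S I = \<Squnion>\<^bsub>Idg S\<^esub> (sigma S ` zprinc S ` I)"
    using \<sigma>_sup[OF S, of "zprinc S ` I"] zS(1) by auto
  also have "sigma S ` zprinc S ` I = (\<lambda>a. gcl S (zprinc S a)) ` I"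
    unfolding image_image by (intro image_cong) (simp_all add: \<sigma>_eq zS)
  finally have "Idg_map S T \<phi> (sigma S I)
      = \<Squnion>\<^bsub>Idg T\<^esub> (Idg_map S T \<phi> ` (\<lambda>a. gcl S (zprinc S a)) ` I)"
    unfolding maps Idg_def using gS by (simp only:) (rule g.extension_sup, auto)
  \<comment> \<open>Here the condition imposed on arrows enters, through
    \<open>CRig_g_sigma_def\<close>.\<close>
  also have "Idg_map S T \<phi> ` (\<lambda>a. gcl S (zprinc S a)) ` I = sigma T ` (\<lambda>a. zprinc T (\<phi> a)) ` I"
    unfolding image_image using \<phi> IS
    by (intro image_cong) (auto simp: \<sigma>_eq zS CRig_g_sigma_def)
  also have "\<Squnion>\<^bsub>Idg T\<^esub> \<dots> = sigma T (\<Squnion>\<^bsub>ZId T\<^esub> ((\<lambda>a. zprinc T (\<phi> a)) ` I))"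
    using zS(2) by (intro \<sigma>_sup[OF T, symmetric]) auto
  also have "\<Squnion>\<^bsub>ZId T\<^esub> ((\<lambda>a. zprinc T (\<phi> a)) ` I) = zcl T (\<phi> ` I)"
    using zS(2) \<phi>I z.T.cl_UN_singletons[of "\<phi> ` I"] unfolding ZId_def
    by (subst z.T.sup_eq) (auto simp: z.T.zprinc_eq image_image)
  also have "\<dots> = ZId_map S T \<phi> I"
    using I by (simp add: maps extension_def)
  finally show ?thesis ..
qed

theorem proposition10p4:
  shows "is_natural_transformation
           (CRig_g_sigma :: ('a ring, 'a \<Rightarrow> 'a) cat)
           (CohFrm :: ('a set gorder, 'a set \<Rightarrow> 'a set) cat)
           ZId_functor Idg_functor sigma"
  unfolding is_natural_transformation_def
proof (intro conjI ballI functor_ZId functor_Idg)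
  show "sigma S \<in> Hom CohFrm (omap ZId_functor S) (omap Idg_functor S)"
    if "S \<in> Obj CRig_g_sigma" for S :: "'a ring"
    using CRig_g_sigma_objD(4)[OF that] by (simp add: CohFrm_def ZId_functor_def Idg_functor_def)
  show "Cmp CohFrm (omap ZId_functor S) (omap ZId_functor T) (omap Idg_functor T)
        (sigma T) (amap ZId_functor S T \<phi>)
      = Cmp CohFrm (omap ZId_functor S) (omap Idg_functor S) (omap Idg_functor T)
        (amap Idg_functor S T \<phi>) (sigma S)"
    if "S \<in> Obj CRig_g_sigma" "T \<in> Obj CRig_g_sigma" "\<phi> \<in> Hom CRig_g_sigma S T"
    for S T :: "'a ring" and \<phi>
    \<comment> \<open>Both composites are restricted to the z-ideals of S, so agreement there is
      equality of arrows.\<close>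
    using sigma_natural[OF that]
    by (auto simp: CohFrm_def ZId_functor_def Idg_functor_def compose_def ZId_def
        inclusion_order_def intro!: restrict_ext)
qed

end
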